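(* Let $\alpha_1,\dots,\alpha_N>0$ and let $W(x)=e^{-x^2}L(x)L(x)^*$, $x\in\mathbb{R}$, where $L(x)_{j,k}=\frac{H_{j-k}(x)}{(j-k)!}\frac{\alpha_j}{\alpha_k}$ for $j\ge k$ and $L(x)_{j,k}=0$ for $j<k$. Let $P(x,n)$ be the monic matrix valued orthogonal polynomials with respect to $W$, with (diagonal) squared norms $\mathcal{H}(n)$, let $Q(x,n)=P(x,n)e^{-x^2/2}L(x)$, and let $\xi(n,j,k)$ be the constants with $Q(x,n)_{j,k}=\xi(n,j,k)H_{n+j-k}(x)e^{-x^2/2}$ for $n+j-k\ge0$, and $\xi(n,j,k)=0$ for $n+j-k<0$. Then for all $n\ge1$, $1\le k\le N$ and $2\le j\le N-1$, $$\xi(n,j-1,k)=\left(\frac{\alpha_{j-1}}{\alpha_j}(n+j-k)+2\frac{\alpha_{j-1}\alpha_{j+1}^2}{\alpha_j^3}\frac{\mathcal{H}(n)_{jj}}{\mathcal{H}(n)_{j+1,j+1}}-2\frac{\alpha_{j-1}}{\alpha_j}\frac{\mathcal{H}(n)_{jj}}{\mathcal{H}(n-1)_{jj}}\right)\xi(n,j,k)$$ $$\qquad-2(n+j-k+1)\frac{\alpha_{j-1}\alpha_{j+1}}{\alpha_j^2}\frac{\mathcal{H}(n)_{jj}}{\mathcal{H}(n)_{j+1,j+1}}\,\xi(n,j+1,k),$$ and for $j=N$, $$\xi(n,N-1,k)=\left(\frac{\alpha_{N-1}}{\alpha_N}(n+N-k)-2\frac{\alpha_{N-1}}{\alpha_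N}\frac{\mathcal{H}(n)_{NN}}{\mathcal{H}(n-1)_{NN}}\right)\xi(n,N,k).$$
   Context: $H_n$ are the standard (physicists') Hermite polynomials (leading coefficient $2^n$). With $\langle F,G\rangle=\int_{\mathbb{R}}F(y)W(y)G(y)^*\,dy$, the monic MVOPs $P(x,n)=x^nI+\cdots$ satisfy $\langle P(\cdot,n),P(\cdot,m)\rangle=\mathcal{H}(n)\delta_{n,m}$. For this weight all $\mathcal{H}(n)$ are diagonal, and each entry $Q(x,n)_{j,k}$ is a constant multiple of $H_{n+j-k}(x)e^{-x^2/2}$ if $n+j-k\ge0$ and is identically $0$ if $n+j-k<0$, so the constants $\xi(n,j,k)$ are well defined. *)

theory Defs
  imports "Jordan_Normal_Form.Schur_Decomposition" "HOL-Analysis.Analysis"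
begin

(* Physicists' normalisation: hermite n has leading coefficient 2 ^ n.  The Rodrigues
   formula is lemma hermite_rodrigues below. *)
fun hermite :: "nat \<Rightarrow> real poly" where
  "hermite 0 = 1"
| "hermite (Suc 0) = [:0, 2:]"
| "hermite (Suc (Suc n)) = [:0, 2:] * hermite (Suc n) - Polynomial.smult (2 * real (Suc n)) (hermite n)"

abbreviation hermite_fun :: "nat \<Rightarrow> real \<Rightarrow> real" where
  "hermite_fun n x \<equiv> poly (hermite n) x"

lemma pderiv_hermite: "pderiv (hermite (Suc n)) = Polynomial.smult (2 * real (Suc n)) (hermite n)"
proof (induction n rule: hermite.induct)
  case 1
  show ?case by (simp add: pderiv_pCons)
next
  case 2
  show ?case by (simp add: pderiv_pCons pderiv_diff pderiv_mult one_pCons)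
next
  case (3 n)
  have "pderiv (hermite (Suc (Suc (Suc n)))) =
    Polynomial.smult 2 (hermite (Suc (Suc n))) + [:0, 2:] * pderiv (hermite (Suc (Suc n)))
      - Polynomial.smult (2 * real (Suc (Suc n))) (pderiv (hermite (Suc n)))"
    by (subst hermite.simps(3))
      (simp add: pderiv_diff pderiv_mult pderiv_smult pderiv_pCons del: hermite.simps(3))
  also have "\<dots> = Polynomial.smult 2 (hermite (Suc (Suc n))) + Polynomial.smult (2 * real (Suc (Suc n)))
      ([:0, 2:] * hermite (Suc n) - Polynomial.smult (2 * real (Suc n)) (hermite n))"
    by (simp only: 3 smult_diff_right smult_smult mult_smult_right add_diff_eq)
  also have "\<dots> = Polynomial.smult (2 + 2 * real (Suc (Suc n))) (hermite (Suc (Suc n)))"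
    by (simp only: hermite.simps(3)[symmetric] smult_add_left[symmetric])
  finally show ?case by (simp del: hermite.simps(3) add: algebra_simps)
qed

lemma lead_coeff_hermite: "degree (hermite n) \<le> n \<and> coeff (hermite n) n = 2 ^ n"
proof (induction n rule: hermite.induct)
  case (3 n)
  have "degree (hermite (Suc (Suc n))) \<le> Suc (Suc n)"
  proof (simp del: mult_pCons_left, rule degree_diff_le)
    show "degree ([:0, 2:] * hermite (Suc n)) \<le> Suc (Suc n)"
      using 3 degree_mult_le[of "[:0, 2:]" "hermite (Suc n)"] by simp
    show "degree (Polynomial.smult (2 + 2 * real n) (hermite n)) \<le> Suc (Suc n)"
      using 3 degree_smult_le[of "2 + 2 * real n" "hermite n"] by linarith
  qed
  moreover have "coeff (hermite n) (Suc (Suc n)) = 0"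
    using 3 by (intro coeff_eq_0) auto
  ultimately show ?case using 3 by simp
qed simp_all

lemma hermite_rodrigues:
  "hermite_fun n x = (- 1) ^ n * exp (x\<^sup>2) * (deriv ^^ n) (\<lambda>t. exp (- t\<^sup>2)) x"
proof -
  have "(deriv ^^ n) (\<lambda>t. exp (- t\<^sup>2)) = (\<lambda>t. (- 1) ^ n * hermite_fun n t * exp (- t\<^sup>2))"
  proof (induction n)
    case 0
    show ?case by simp
  next
    case (Suc n)
    have *: "hermite_fun (Suc n) t = 2 * t * hermite_fun n t - poly (pderiv (hermite n)) t" for t
      by (cases n) (simp_all add: pderiv_hermite del: of_nat_Suc)
    have "deriv (\<lambda>t. (- 1) ^ n * hermite_fun n t * exp (- t\<^sup>2)) t =
        (- 1) ^ Suc n * hermite_fun (Suc n) t * exp (- t\<^sup>2)" for t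
      unfolding *
      by (rule DERIV_imp_deriv)
        (auto intro!: derivative_eq_intros poly_DERIV simp: algebra_simps)
    then show ?case unfolding funpow.simps(2) comp_def Suc by blast
  qed
  then have "(- 1) ^ n * exp (x\<^sup>2) * (deriv ^^ n) (\<lambda>t. exp (- t\<^sup>2)) x =
      ((- 1) ^ n * (- 1) ^ n) * (exp (x\<^sup>2) * exp (- x\<^sup>2)) * hermite_fun n x"
    by (simp only: mult_ac)
  also have "(- 1) ^ n * (- 1) ^ n = (1 :: real)"
    by (simp flip: power_mult_distrib)
  also have "exp (x\<^sup>2) * exp (- x\<^sup>2) = 1"
    by (simp flip: exp_add)
  finally show ?thesis by simp
qed

(* Library matrices are indexed from 0; these two put the indices 1, ..., N on them. *)
definition mat1 :: "nat \<Rightarrow> (nat \<Rightarrow> nat \<Rightarrow> 'a) \<Rightarrow> 'a mat" where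
  "mat1 N f = Matrix.mat N N (\<lambda>(i, k). f (Suc i) (Suc k))"

definition entry :: "'a mat \<Rightarrow> nat \<Rightarrow> nat \<Rightarrow> 'a" where
  "entry A j k = A $$ (j - 1, k - 1)"

definition L_mat :: "nat \<Rightarrow> (nat \<Rightarrow> real) \<Rightarrow> real \<Rightarrow> complex mat" where
  "L_mat N \<alpha> x = mat1 N (\<lambda>j k.
     if k \<le> j then of_real (hermite_fun (j - k) x / fact (j - k) * (\<alpha> j / \<alpha> k)) else 0)"

definition weight :: "nat \<Rightarrow> (nat \<Rightarrow> real) \<Rightarrow> real \<Rightarrow> complex mat" where
  "weight N \<alpha> x = of_real (exp (- x\<^sup>2)) \<cdot>\<^sub>m (L_mat N \<alpha> x * mat_adjoint (L_mat N \<alpha> x))"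

definition mat_inner ::
  "nat \<Rightarrow> (real \<Rightarrow> complex mat) \<Rightarrow> (real \<Rightarrow> complex mat) \<Rightarrow> (real \<Rightarrow> complex mat) \<Rightarrow> complex mat"
where
  "mat_inner N W F G = mat1 N (\<lambda>j k. LBINT y. entry (F y * W y * mat_adjoint (G y)) j k)"

(* A matrix valued polynomial is a matrix with polynomial entries. *)
definition mpoly_eval :: "complex poly mat \<Rightarrow> real \<Rightarrow> complex mat" where
  "mpoly_eval A x = map_mat (\<lambda>p. poly p (of_real x)) A"

definition monic_mpoly :: "nat \<Rightarrow> nat \<Rightarrow> complex poly mat \<Rightarrow> bool" where
  "monic_mpoly N n A \<longleftrightarrow> A \<in> carrier_mat N N \<and>
     (\<forall>p \<in> elements_mat A. degree p \<le> n) \<and> map_mat (\<lambda>p. coeff p n) A = 1\<^sub>m N"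

definition sq_norm_mat ::
  "nat \<Rightarrow> (real \<Rightarrow> complex mat) \<Rightarrow> (nat \<Rightarrow> complex poly mat) \<Rightarrow> nat \<Rightarrow> complex mat"
where
  "sq_norm_mat N W P n = mat_inner N W (mpoly_eval (P n)) (mpoly_eval (P n))"

definition monic_mvops ::
  "nat \<Rightarrow> (real \<Rightarrow> complex mat) \<Rightarrow> (nat \<Rightarrow> complex poly mat) \<Rightarrow> bool"
where
  "monic_mvops N W P \<longleftrightarrow> (\<forall>n. monic_mpoly N n (P n)) \<and>
     (\<forall>n m. n \<noteq> m \<longrightarrow> mat_inner N W (mpoly_eval (P n)) (mpoly_eval (P m)) = 0\<^sub>m N N)"

definition Q_fun ::
  "nat \<Rightarrow> (nat \<Rightarrow> real) \<Rightarrow> (nat \<Rightarrow> complex poly mat) \<Rightarrow> nat \<Rightarrow> real \<Rightarrow> complex mat"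
where
  "Q_fun N \<alpha> P n x = of_real (exp (- x\<^sup>2 / 2)) \<cdot>\<^sub>m (mpoly_eval (P n) x * L_mat N \<alpha> x)"

definition xi ::
  "nat \<Rightarrow> (nat \<Rightarrow> real) \<Rightarrow> (nat \<Rightarrow> complex poly mat) \<Rightarrow> nat \<Rightarrow> nat \<Rightarrow> nat \<Rightarrow> complex"
where
  "xi N \<alpha> P n j k =
     (if k \<le> n + j
      then (THE c. \<forall>x. entry (Q_fun N \<alpha> P n x) j k
                       = c * of_real (hermite_fun (n + j - k) x * exp (- x\<^sup>2 / 2)))
      else 0)"

end

theory Submission
  imports Defs "HOL-Probability.Distributions"
begin

text \<open>Put \<open>R(n) = P(n) L\<close>. Its entries are polynomials, and orthogonality of the \<open>P(n)\<close> with respect to \<open>W\<close>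
says that rows of \<open>R(n)\<close> and \<open>R(m)\<close> are orthogonal, for \<open>n \<noteq> m\<close>, in the inner product that sums the
scalar integrals with weight \<open>exp (- x\<^sup>2)\<close> over the components. As \<open>P(n)\<close> is monic, the rows of
\<open>R(0), \<dots>, R(d - 1)\<close> span all products \<open>q L\<close> with a row \<open>q\<close> of polynomials of degree less than \<open>d\<close>. Hence
such a product vanishes as soon as it is orthogonal to these rows, which is lemma
\<open>deg_less_orthogonal_eq_0\<close>. All identities below are obtained by applying it to a difference of two sides
whose terms of degree \<open>d\<close> cancel.

Let \<open>A\<close> be the nilpotent matrix with entries \<open>\<alpha>\<^sub>j / \<alpha>\<^sub>j\<^sub>-\<^sub>1\<close> at the places \<open>(j, j - 1)\<close>, and let \<open>J\<close> be the diagonal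
matrix of \<open>1, \<dots>, N\<close>. The generating function of the Hermite polynomials gives \<open>L = exp (2 x A - A\<^sup>2)\<close>, so
\<open>L' = 2 A L\<close> and \<open>L J = (J - 2 x A + 2 A\<^sup>2) L\<close>. Therefore three operators on rows of polynomials send products
\<open>q L\<close> to such products with control of the degree of \<open>q\<close>: the derivative, its adjoint \<open>2 x - d/dx\<close>, and the
symmetric operator \<open>u \<mapsto> 2 x u' - u'' + 2 u J\<close>. Their actions on \<open>R(n)\<close> are as follows.

The symmetric operator maps \<open>q L\<close> to \<open>(2 x q' - q'' - 4 q' A + 2 q J) L\<close>. It multiplies row \<open>j\<close> of \<open>R(n)\<close> by
\<open>2 (n + j)\<close> (\<open>PL_eigen\<close>). Componentwise this is the Hermite differential equation with index \<open>n + j - k\<close>,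
so that \<open>R(n)\<^sub>j\<^sub>k = \<xi>(n, j, k) H\<^sub>n\<^sub>+\<^sub>j\<^sub>-\<^sub>k\<close>; and rows of the same \<open>R(n)\<close> are orthogonal because their
eigenvalues differ, so that the squared norms are diagonal.

For the derivative and its adjoint, comparison of leading terms and of inner products gives
\<open>R(n)' = 2 A R(n) + 2 \<H>(n) \<H>(n - 1)\<^sup>-\<^sup>1 R(n - 1)\<close> (\<open>lowering_relation\<close>) and
\<open>2 x R(n - 1) - R(n - 1)' = 2 R(n) + 2 \<H>(n - 1) A\<^sup>* \<H>(n - 1)\<^sup>-\<^sup>1 R(n - 1)\<close> (\<open>raising_relation\<close>).
Since \<open>H\<^sub>m' = 2 m H\<^sub>m\<^sub>-\<^sub>1\<close> and \<open>2 x H\<^sub>m - H\<^sub>m' = H\<^sub>m\<^sub>+\<^sub>1\<close>, both turn into linear relations between the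
\<open>\<xi>(n, \<cdot>, k)\<close> and \<open>\<xi>(n - 1, \<cdot>, k)\<close> with \<open>k\<close> fixed. The lowering relation in row \<open>j\<close> expresses
\<open>\<xi>(n, j - 1, k)\<close> by \<open>\<xi>(n, j, k)\<close> and \<open>\<xi>(n - 1, j, k)\<close>; the latter is eliminated by the raising relation in
row \<open>j\<close> and the lowering relation in row \<open>j + 1\<close>. In the last row the term with \<open>A\<^sup>*\<close> is absent, which gives
the second formula.\<close>

section \<open>The Gaussian inner product of polynomials\<close>

lemma gaussian_moment:
  "has_bochner_integral lborel (\<lambda>x::real. x ^ (2 * k) * exp (- x\<^sup>2))
           (sqrt pi * (fact (2 * k) / (2 ^ (2 * k) * fact k)))"
  "has_bochner_integral lborel (\<lambda>x::real. x ^ (2 * k + 1) * exp (- x\<^sup>2)) 0"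
  using has_bochner_integral_even_function[OF gaussian_moment_even_pos[of k]]
    has_bochner_integral_odd_function[OF gaussian_moment_odd_pos[of k]]
  by (simp_all add: mult_ac)

lemma integrable_monomial_gaussian: "integrable lborel (\<lambda>x::real. x ^ i * exp (- x\<^sup>2))"
proof (cases "even i")
  case True
  then show ?thesis using gaussian_moment(1) by (auto elim!: evenE simp: has_bochner_integral_iff)
next
  case False
  then show ?thesis using gaussian_moment(2) by (auto elim!: oddE simp: has_bochner_integral_iff)
qed

text \<open>Integration by parts for a monomial. The explicit moments make it an identity between factorials, so
that no boundary terms have to be estimated.\<close>

lemma gaussian_moment_rec:
  "(LBINT x. 2 * x * x ^ Suc i * exp (- x\<^sup>2)) = (LBINT x. real (Suc i) * x ^ i * exp (- x\<^sup>2))"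
proof -
  define M where "M j = (LBINT x::real. x ^ j * exp (- x\<^sup>2))" for j
  have even: "M (2 * k) = sqrt pi * (fact (2 * k) / (2 ^ (2 * k) * fact k))" for k
    unfolding M_def by (rule has_bochner_integral_integral_eq[OF gaussian_moment(1)])
  have odd: "M (2 * k + 1) = 0" for k
    unfolding M_def by (rule has_bochner_integral_integral_eq[OF gaussian_moment(2)])
  have "2 * M (i + 2) = real (Suc i) * M i"
  proof (cases "even i")
    case True
    then obtain k where i: "i = 2 * k" by (elim evenE)
    have "2 * (fact (2 * (k + 1)) / (2 ^ (2 * (k + 1)) * fact (k + 1))) =
        real (Suc i) * (fact (2 * k) / (2 ^ (2 * k) * fact k))"
      by (simp add: i divide_simps)
    then have "sqrt pi * (2 * (fact (2 * (k + 1)) / (2 ^ (2 * (k + 1)) * fact (k + 1)))) =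
        sqrt pi * (real (Suc i) * (fact (2 * k) / (2 ^ (2 * k) * fact k)))"
      by (rule arg_cong)
    then have "2 * M (2 * (k + 1)) = real (Suc i) * M (2 * k)"
      unfolding even by (simp only: mult.left_commute)
    then show ?thesis by (simp add: i)
  next
    case False
    then obtain k where "i = 2 * k + 1" by (elim oddE)
    then show ?thesis using odd[of k] odd[of "k + 1"] by simp
  qed
  then show ?thesis
    unfolding M_def by (simp add: mult_ac flip: integral_mult_right_zero)
qed

definition gauss :: "complex poly \<Rightarrow> complex" where
  "gauss p = (LBINT x. poly p (of_real x) * of_real (exp (- x\<^sup>2)))"

lemma integrable_gauss:
  "integrable lborel (\<lambda>x. poly p (complex_of_real x) * of_real (exp (- x\<^sup>2)))"
proof -
  have "integrable lborel (\<lambda>x. coeff p i * complex_of_real (x ^ i * exp (- x\<^sup>2)))" for i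
    by (intro integrable_mult_right integrable_of_real integrable_monomial_gaussian)
  then have "integrable lborel (\<lambda>x. \<Sum>i\<le>degree p. coeff p i * complex_of_real (x ^ i * exp (- x\<^sup>2)))"
    by (intro Bochner_Integration.integrable_sum)
  then show ?thesis by (simp add: poly_altdef sum_distrib_right mult.assoc)
qed

lemma gauss_add: "gauss (p + q) = gauss p + gauss q"
  unfolding gauss_def
  by (subst Bochner_Integration.integral_add[symmetric]) (simp_all add: integrable_gauss distrib_right)

lemma gauss_smult: "gauss (Polynomial.smult c p) = c * gauss p"
  unfolding gauss_def by (simp add: mult.assoc)

lemma gauss_0 [simp]: "gauss 0 = 0"
  by (simp add: gauss_def)

lemma gauss_sum: "gauss (sum f A) = (\<Sum>i\<in>A. gauss (f i))"
  by (induction A rule: infinite_finite_induct) (simp_all add: gauss_add)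

text \<open>The integral of \<open>(p(x) exp (- x\<^sup>2))'\<close> over the real line vanishes.\<close>

lemma gauss_pderiv: "gauss (pderiv p) = gauss ([:0, 2:] * p)"
proof -
  have mono: "gauss (pderiv (monom c i)) = gauss ([:0, 2:] * monom c i)" for c i
  proof (cases i)
    case 0
    have "(LBINT x::real. x * exp (- x\<^sup>2)) = 0"
      using has_bochner_integral_integral_eq[OF gaussian_moment(2)[of 0]] by simp
    then have "gauss [:0, 1:] = 0"
      unfolding gauss_def by (simp flip: of_real_mult)
    moreover have "[:0, 2:] * monom c 0 = Polynomial.smult (2 * c) [:0, 1:]"
      by (simp add: monom_0)
    ultimately show ?thesis using 0
      by (simp only: gauss_smult pderiv_monom) simp
  next
    case (Suc j)
    have "(LBINT x. of_real (2 * x * x ^ Suc j * exp (- x\<^sup>2))) =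
        (LBINT x. complex_of_real (real (Suc j) * x ^ j * exp (- x\<^sup>2)))"
      by (simp only: integral_complex_of_real gaussian_moment_rec)
    then have "c * (LBINT x. of_real (2 * x * x ^ Suc j * exp (- x\<^sup>2))) =
        c * (LBINT x. complex_of_real (real (Suc j) * x ^ j * exp (- x\<^sup>2)))" by simp
    then show ?thesis
      unfolding gauss_def Suc
      by (simp add: pderiv_monom poly_monom mult_ac flip: integral_mult_right_zero)
  qed
  have "pderiv p = (\<Sum>i\<le>degree p. pderiv (monom (coeff p i) i))"
    by (subst poly_as_sum_of_monoms[of p, symmetric]) (simp only: higher_pderiv_sum pderiv_sum)
  then have "gauss (pderiv p) = (\<Sum>i\<le>degree p. gauss ([:0, 2:] * monom (coeff p i) i))"
    by (simp add: gauss_sum mono)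
  also have "\<dots> = gauss ([:0, 2:] * p)"
    by (simp only: gauss_sum[symmetric] sum_distrib_left[symmetric] poly_as_sum_of_monoms)
  finally show ?thesis .
qed

interpretation cnj_poly: map_poly_comm_ring_hom cnj
  by unfold_locales auto

interpretation of_real_poly: map_poly_comm_ring_hom "of_real :: real \<Rightarrow> complex"
  by unfold_locales auto

lemma pderiv_map_poly_cnj: "pderiv (map_poly cnj p) = map_poly cnj (pderiv p)"
  by (rule poly_eqI) (simp add: coeff_pderiv coeff_map_poly)

lemma map_poly_cnj_cnj: "map_poly cnj (map_poly cnj p) = p"
  by (rule poly_eqI) (simp add: coeff_map_poly)

definition gauss_inner :: "complex poly \<Rightarrow> complex poly \<Rightarrow> complex" where
  "gauss_inner p q = gauss (p * map_poly cnj q)"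

lemma gauss_inner_linear:
  "gauss_inner (p + p') q = gauss_inner p q + gauss_inner p' q"
  "gauss_inner (p - p') q = gauss_inner p q - gauss_inner p' q"
  "gauss_inner (Polynomial.smult c p) q = c * gauss_inner p q"
proof -
  have neg: "gauss (- r) = - gauss r" for r
    using gauss_smult[of "-1" r] by simp
  show "gauss_inner (p + p') q = gauss_inner p q + gauss_inner p' q"
    by (simp add: gauss_inner_def distrib_right gauss_add)
  show "gauss_inner (p - p') q = gauss_inner p q - gauss_inner p' q"
    using gauss_add[of "p * map_poly cnj q" "- (p' * map_poly cnj q)"]
    by (simp add: gauss_inner_def left_diff_distrib neg)
  show "gauss_inner (Polynomial.smult c p) q = c * gauss_inner p q"
    by (simp add: gauss_inner_def gauss_smult)
qed

lemma gauss_inner_commute: "gauss_inner p q = cnj (gauss_inner q p)"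
proof -
  have "cnj (gauss r) = gauss (map_poly cnj r)" for r
    unfolding gauss_def by (subst Bochner_Integration.integral_cnj[symmetric]) simp
  then show ?thesis
    by (simp add: gauss_inner_def cnj_poly.hom_mult map_poly_cnj_cnj mult.commute)
qed

lemma gauss_inner_linear_right:
  "gauss_inner q (p + p') = gauss_inner q p + gauss_inner q p'"
  "gauss_inner q (p - p') = gauss_inner q p - gauss_inner q p'"
  "gauss_inner q (Polynomial.smult c p) = cnj c * gauss_inner q p"
  unfolding gauss_inner_commute[of q "p + p'"] gauss_inner_commute[of q "p - p'"]
    gauss_inner_commute[of q "Polynomial.smult c p"]
    gauss_inner_linear gauss_inner_commute[of q p] gauss_inner_commute[of q p'] by simp_all

text \<open>The adjoint of the derivative is \<open>2 x - d/dx\<close>: this is integration by parts applied to \<open>p\<close> times the conjugate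
of \<open>q\<close>.\<close>

lemma gauss_inner_pderiv: "gauss_inner (pderiv p) q = gauss_inner p ([:0, 2:] * q - pderiv q)"
proof -
  have c: "map_poly cnj [:0, 2:] = [:0, 2:]" by (simp add: map_poly_pCons)
  have "gauss (pderiv (p * map_poly cnj q)) = gauss ([:0, 2:] * (p * map_poly cnj q))"
    by (rule gauss_pderiv)
  moreover have "pderiv (p * map_poly cnj q) =
      pderiv p * map_poly cnj q + p * map_poly cnj (pderiv q)"
    by (simp add: pderiv_mult pderiv_map_poly_cnj)
  moreover have "[:0, 2:] * (p * map_poly cnj q) =
      p * map_poly cnj ([:0, 2:] * q - pderiv q) + p * map_poly cnj (pderiv q)"
    unfolding cnj_poly.hom_minus cnj_poly.hom_mult c by (simp only: algebra_simps)
  ultimately show ?thesis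
    unfolding gauss_inner_def by (simp only: gauss_add) simp
qed

lemma gauss_inner_self: "gauss_inner p p = of_real (LBINT x. (cmod (poly p (of_real x)))\<^sup>2 * exp (- x\<^sup>2))"
proof -
  have "poly (p * map_poly cnj p) (complex_of_real x) * of_real (exp (- x\<^sup>2)) =
     complex_of_real ((cmod (poly p (of_real x)))\<^sup>2 * exp (- x\<^sup>2))" for x
    by (simp add: complex_norm_square del: of_real_power)
  then show ?thesis
    unfolding gauss_inner_def gauss_def by (simp only: integral_complex_of_real)
qed

lemma gauss_inner_nonneg: "Re (gauss_inner p p) \<ge> 0" "Im (gauss_inner p p) = 0"
  by (simp_all add: gauss_inner_self integral_nonneg_AE)

text \<open>If the norm is \<open>0\<close>, then \<open>p\<close> vanishes almost everywhere on the real line; a nonzero polynomial vanishes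
only at finitely many points.\<close>

lemma gauss_inner_definite:
  assumes "gauss_inner p p = 0" shows "p = 0"
proof (rule ccontr)
  assume nz: "p \<noteq> 0"
  let ?f = "\<lambda>x. (cmod (poly p (of_real x)))\<^sup>2 * exp (- x\<^sup>2)"
  have "integrable lborel (\<lambda>x. complex_of_real (?f x))"
    using integrable_gauss[of "p * map_poly cnj p"]
    by (simp add: complex_norm_square del: of_real_power)
  then have "integrable lborel ?f" by (simp only: complex_of_real_integrable_eq)
  moreover have "integral\<^sup>L lborel ?f = 0" using assms unfolding gauss_inner_self by simp
  ultimately have "AE x in lborel. ?f x = 0"
    by (subst integral_nonneg_eq_0_iff_AE[symmetric]) auto
  then have "AE x in lborel. poly p (complex_of_real x) = 0" by simp
  moreover have "AE x in lborel. x \<notin> {x. poly p (complex_of_real x) = 0}"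
  proof -
    have "finite (complex_of_real -` {z. poly p z = 0})"
      by (rule finite_vimageI[OF poly_roots_finite[OF nz]]) (simp add: inj_on_def)
    then have "{x. poly p (complex_of_real x) = 0} \<in> null_sets lborel"
      by (intro finite_imp_null_set_lborel) (simp add: vimage_def)
    then show ?thesis by (rule AE_not_in)
  qed
  ultimately have "AE x::real in lborel. False" by eventually_elim simp
  then have "UNIV \<in> null_sets (lborel :: real measure)" by (simp add: AE_iff_null_sets)
  then show False by (auto dest: null_setsD1)
qed

section \<open>The Hermite differential equation\<close>

definition hermite_c :: "nat \<Rightarrow> complex poly" where
  "hermite_c n = map_poly of_real (hermite n)"

lemma poly_hermite_c [simp]: "poly (hermite_c n) (of_real x) = of_real (hermite_fun n x)"
  by (simp add: hermite_c_def)

lemma pderiv_map_poly_of_real: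
  "pderiv (map_poly of_real p) = (map_poly of_real (pderiv p) :: complex poly)"
  by (rule poly_eqI) (simp add: coeff_pderiv coeff_map_poly)

lemma map_poly_of_real_smult:
  "map_poly of_real (Polynomial.smult c p) = Polynomial.smult (complex_of_real c) (map_poly of_real p)"
  by (rule poly_eqI) (simp add: coeff_map_poly)

lemma pderiv_hermite_c:
  "pderiv (hermite_c n) = Polynomial.smult (2 * of_nat n) (hermite_c (n - 1))"
  by (cases n)
    (simp_all add: hermite_c_def pderiv_map_poly_of_real pderiv_hermite map_poly_of_real_smult
       of_real_poly.hom_one del: hermite.simps(2-) of_nat_Suc)

lemma hermite_c_Suc:
  "hermite_c (Suc n) = [:0, 2:] * hermite_c n - pderiv (hermite_c n)"
proof -
  have c: "map_poly complex_of_real [:0, 2:] = [:0, 2:]" by (simp add: map_poly_pCons)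
  have "hermite (Suc n) = [:0, 2:] * hermite n - pderiv (hermite n)"
    by (cases n) (simp_all add: pderiv_hermite del: of_nat_Suc mult_pCons_left)
  then show ?thesis
    unfolding hermite_c_def pderiv_map_poly_of_real c[symmetric]
    by (metis of_real_poly.hom_minus of_real_poly.hom_mult)
qed

lemma hermite_c_0 [simp]: "hermite_c 0 = 1"
  by (simp add: hermite_c_def)

lemma coeff_hermite_c: "i > n \<Longrightarrow> coeff (hermite_c n) i = 0" "coeff (hermite_c n) n = 2 ^ n"
  using lead_coeff_hermite[of n] by (auto simp: hermite_c_def coeff_map_poly coeff_eq_0)

definition hermite_op :: "complex poly \<Rightarrow> complex poly" where
  "hermite_op p = [:0, 2:] * pderiv p - pderiv (pderiv p)"

text \<open>The operator is triangular with diagonal entries \<open>2 i\<close>; this determines its eigenvalues.\<close>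

lemma coeff_hermite_op:
  "coeff (hermite_op p) i = 2 * of_nat i * coeff p i - of_nat (i + 1) * of_nat (i + 2) * coeff p (i + 2)"
  by (cases i) (simp_all add: hermite_op_def coeff_pderiv coeff_pCons algebra_simps)

lemma hermite_op_hermite_c:
  "hermite_op (hermite_c n) = Polynomial.smult (2 * of_nat n) (hermite_c n)"
proof (cases n)
  case (Suc m)
  have "hermite_op (hermite_c n) = Polynomial.smult (2 * of_nat n) ([:0, 2:] * hermite_c m - pderiv (hermite_c m))"
    unfolding hermite_op_def pderiv_hermite_c[of n]
    by (simp add: Suc pderiv_smult smult_diff_right del: mult_pCons_left of_nat_Suc)
  then show ?thesis by (simp only: hermite_c_Suc Suc)
qed (simp add: hermite_op_def)

text \<open>\<open>hermite_op\<close> is the derivative followed by the adjoint of the derivative, hence symmetric.\<close>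

lemma gauss_inner_hermite_op: "gauss_inner (hermite_op p) q = gauss_inner p (hermite_op q)"
proof -
  have "gauss_inner (hermite_op p) q = cnj (gauss_inner (pderiv q) (pderiv p))"
    unfolding gauss_inner_pderiv hermite_op_def by (rule gauss_inner_commute)
  also have "\<dots> = gauss_inner p (hermite_op q)"
    unfolding hermite_op_def gauss_inner_pderiv[symmetric] by (rule gauss_inner_commute[symmetric])
  finally show ?thesis .
qed

text \<open>The leading coefficient of an eigenvector forces the eigenvalue to be twice its degree. Subtracting the
multiple of the Hermite polynomial with the same leading coefficient leaves an eigenvector of smaller
degree for the same eigenvalue, which must be \<open>0\<close>.\<close>

lemma hermite_eigenvector:
  assumes "hermite_op p = Polynomial.smult (2 * of_int z) p"
  shows "\<exists>c. p = (if z \<ge> 0 then Polynomial.smult c (hermite_c (nat z)) else 0)"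
proof -
  have deg: "q = 0" if q: "hermite_op q = Polynomial.smult (2 * of_int z) q" "int (degree q) \<noteq> z" for q
  proof -
    have "coeff (hermite_op q) (degree q) = 2 * of_nat (degree q) * lead_coeff q"
      by (simp add: coeff_hermite_op coeff_eq_0)
    then have eq: "2 * of_nat (degree q) * lead_coeff q = 2 * of_int z * lead_coeff q"
      using arg_cong[OF q(1), of "\<lambda>r. coeff r (degree q)"] by (simp only: coeff_smult)
    have "2 * (of_int (int (degree q) - z) * lead_coeff q) =
        2 * of_nat (degree q) * lead_coeff q - 2 * of_int z * lead_coeff q"
      by (simp add: algebra_simps)
    then have "of_int (int (degree q) - z) * lead_coeff q = 0"
      unfolding eq by simp
    moreover have "int (degree q) - z \<noteq> 0" using q by simp
    ultimately have "lead_coeff q = 0" by (metis mult_eq_0_iff of_int_eq_0_iff)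
    then show "q = 0" by simp
  qed
  show ?thesis
  proof (cases "int (degree p) = z")
    case False
    then have "p = 0" using deg assms by blast
    then show ?thesis by (intro exI[of _ 0]) simp
  next
    case True
    define n where "n = degree p"
    have z: "z = int n" using True n_def by simp
    define c where "c = lead_coeff p / 2 ^ n"
    define q where "q = p - Polynomial.smult c (hermite_c n)"
    have lin: "hermite_op q = hermite_op p - Polynomial.smult c (hermite_op (hermite_c n))"
      by (rule poly_eqI) (simp add: q_def coeff_hermite_op algebra_simps)
    have "hermite_op q = Polynomial.smult (2 * of_int z) q"
      unfolding lin assms hermite_op_hermite_c by (simp add: q_def z smult_diff_right mult_ac)
    moreover have "coeff q i = 0" if "i \<ge> n" for i
      using that by (cases "i = n") (auto simp: q_def c_def coeff_hermite_c coeff_eq_0 n_def)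
    then have "q = 0 \<or> degree q \<noteq> n" by (metis leading_coeff_0_iff order_refl)
    ultimately have "q = 0" using deg z by fastforce
    then show ?thesis by (intro exI[of _ c]) (simp add: q_def z)
  qed
qed

lemma hermite_op_smult: "hermite_op (Polynomial.smult c p) = Polynomial.smult c (hermite_op p)"
  by (rule poly_eqI) (simp add: coeff_hermite_op algebra_simps)

text \<open>The adjoint of the derivative. It raises the index of a Hermite polynomial by one, as the creation operator
of the harmonic oscillator does.\<close>

definition creation :: "complex poly \<Rightarrow> complex poly" where
  "creation p = [:0, 2:] * p - pderiv p"

lemma creation_smult: "creation (Polynomial.smult c p) = Polynomial.smult c (creation p)"
  by (simp add: creation_def pderiv_smult smult_diff_right del: mult_pCons_left)

lemma creation_hermite_c: "creation (hermite_c n) = hermite_c (Suc n)"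
  by (simp only: creation_def hermite_c_Suc)

lemma creation_0 [simp]: "creation 0 = 0"
  by (simp add: creation_def)

lemma coeff_creation:
  "coeff (creation p) i = (if i = 0 then 0 else 2 * coeff p (i - 1)) - of_nat (Suc i) * coeff p (Suc i)"
  by (cases i) (simp_all add: creation_def coeff_pderiv coeff_pCons)

section \<open>Rows of polynomials multiplied by the matrix L\<close>

text \<open>This is \<open>u \<mapsto> 2 x u' - u'' + 2 u J\<close> for rows \<open>u\<close>, where \<open>J\<close> is the diagonal matrix with entries \<open>k\<close>.\<close>

definition second_order :: "(nat \<Rightarrow> complex poly) \<Rightarrow> nat \<Rightarrow> complex poly" where
  "second_order u k = hermite_op (u k) + Polynomial.smult (2 * of_nat k) (u k)"

locale hermite_weight =
  fixes N :: nat and \<alpha> :: "nat \<Rightarrow> real"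
  assumes \<alpha>_nonzero: "\<And>j. j \<in> {1..N} \<Longrightarrow> \<alpha> j \<noteq> 0"
begin

abbreviation a :: "nat \<Rightarrow> complex" where "a j \<equiv> of_real (\<alpha> j)"

definition L_entry :: "nat \<Rightarrow> nat \<Rightarrow> complex poly" where
  "L_entry m k = (if k \<le> m then Polynomial.smult (a m / a k / fact (m - k)) (hermite_c (m - k)) else 0)"

text \<open>This is \<open>L' = 2 A L\<close>. In the first row, \<open>m = 1\<close>, the right-hand side is \<open>0\<close> because \<open>L_entry 0 k\<close> is \<open>0\<close>
for \<open>k \<ge> 1\<close>.\<close>

lemma pderiv_L_entry:
  assumes "k \<in> {1..N}" "m \<in> {1..N}"
  shows "pderiv (L_entry m k) = Polynomial.smult (2 * (a m / a (m - 1))) (L_entry (m - 1) k)"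
proof (cases "k < m")
  case True
  then obtain d where d: "m - k = Suc d" "m - 1 - k = d" "k \<le> m - 1"
    by (metis Suc_diff_Suc diff_Suc_1 diff_commute Suc_leI diff_le_mono diff_Suc_1)
  have "m - 1 \<in> {1..N}" using assms True by auto
  then have "\<alpha> (m - 1) \<noteq> 0" by (rule \<alpha>_nonzero)
  then show ?thesis using True d
    by (simp add: L_entry_def pderiv_smult pderiv_hermite_c field_simps del: of_nat_Suc)
next
  case False
  then show ?thesis using assms by (auto simp: L_entry_def pderiv_smult)
qed

text \<open>The Hermite equation for \<open>H\<^sub>m\<^sub>-\<^sub>k\<close>. Because \<open>L' = 2 A L\<close>, it is the matrix identity
\<open>L J = (J - 2 x A + 2 A\<^sup>2) L\<close>.\<close>

lemma L_entry_rec: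
  assumes "k \<in> {1..N}" "m \<in> {1..N}"
  shows "Polynomial.smult (of_nat k) (L_entry m k) = Polynomial.smult (of_nat m) (L_entry m k)
    - [:0, 1:] * pderiv (L_entry m k) + Polynomial.smult (1/2) (pderiv (pderiv (L_entry m k)))"
proof (cases "k \<le> m")
  case True
  define c where "c = a m / a k / fact (m - k)"
  have e: "L_entry m k = Polynomial.smult c (hermite_c (m - k))" using True by (simp add: L_entry_def c_def)
  have "hermite_op (L_entry m k) = Polynomial.smult (2 * of_nat (m - k)) (L_entry m k)"
    by (simp only: e hermite_op_smult hermite_op_hermite_c smult_smult mult.commute)
  then have "Polynomial.smult (1/2) (hermite_op (L_entry m k)) = Polynomial.smult (of_nat m - of_nat k) (L_entry m k)"
    using True by (simp add: of_nat_diff diff_divide_distrib)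
  moreover have "Polynomial.smult (1/2) (hermite_op (L_entry m k)) = [:0, 1:] * pderiv (L_entry m k)
     - Polynomial.smult (1/2) (pderiv (pderiv (L_entry m k)))"
    by (simp add: hermite_op_def smult_diff_right)
  ultimately show ?thesis by (simp add: smult_diff_left algebra_simps del: mult_pCons_left)
qed (simp add: L_entry_def)

text \<open>A row of length \<open>N\<close> is a function of the column index; \<open>times_L p\<close> is the product of the row \<open>p\<close> with \<open>L\<close>.\<close>

definition times_L :: "(nat \<Rightarrow> complex poly) \<Rightarrow> nat \<Rightarrow> complex poly" where
  "times_L p k = (\<Sum>m=1..N. p m * L_entry m k)"

lemma times_L_add: "times_L (\<lambda>m. p m + q m) k = times_L p k + times_L q k"
  by (simp add: times_L_def distrib_right sum.distrib)

lemma times_L_diff: "times_L (\<lambda>m. p m - q m) k = times_L p k - times_L q k"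
  by (simp add: times_L_def left_diff_distrib sum_subtractf)

lemma times_L_mult: "times_L (\<lambda>m. r * p m) k = r * times_L p k"
  by (simp add: times_L_def sum_distrib_left mult.assoc)

lemma times_L_smult: "times_L (\<lambda>m. Polynomial.smult c (p m)) k = Polynomial.smult c (times_L p k)"
  using times_L_mult[of "[:c:]" p k] by simp

lemma times_L_sum: "times_L (\<lambda>m. \<Sum>i\<in>I. f i m) k = (\<Sum>i\<in>I. times_L (f i) k)"
  unfolding times_L_def sum_distrib_right by (rule sum.swap)

text \<open>The product of the row \<open>p\<close> with the matrix \<open>A\<close> whose only nonzero entries are \<open>\<alpha>\<^sub>j / \<alpha>\<^sub>j\<^sub>-\<^sub>1\<close> at \<open>(j, j - 1)\<close>.\<close>

definition times_A :: "(nat \<Rightarrow> complex poly) \<Rightarrow> nat \<Rightarrow> complex poly" where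
  "times_A p m = (if m < N then Polynomial.smult (a (m + 1) / a m) (p (m + 1)) else 0)"

lemma times_L_times_A:
  assumes "k \<in> {1..N}"
  shows "times_L (times_A p) k = (\<Sum>m=1..N. Polynomial.smult (a m / a (m - 1)) (p m * L_entry (m - 1) k))"
proof -
  have z: "L_entry 0 k = 0" using assms by (simp add: L_entry_def)
  have "times_L (times_A p) k = (\<Sum>m=1..<N. Polynomial.smult (a (m + 1) / a m) (p (m + 1) * L_entry m k))"
    unfolding times_L_def times_A_def by (rule sum.mono_neutral_cong_right) auto
  also have "\<dots> = (\<Sum>m=Suc 1..<Suc N. Polynomial.smult (a m / a (m - 1)) (p m * L_entry (m - 1) k))"
    by (subst sum.shift_bounds_Suc_ivl) simp
  also have "\<dots> = (\<Sum>m=1..N. Polynomial.smult (a m / a (m - 1)) (p m * L_entry (m - 1) k))"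
    by (rule sum.mono_neutral_cong_left) (use z in \<open>auto simp: not_less_eq_eq le_Suc_eq\<close>)
  finally show ?thesis .
qed

lemma times_pderiv_L_entry:
  assumes "k \<in> {1..N}"
  shows "(\<Sum>m=1..N. p m * pderiv (L_entry m k)) = Polynomial.smult 2 (times_L (times_A p) k)"
  unfolding times_L_times_A[OF assms] smult_sum2
  by (rule sum.cong) (use assms in \<open>simp_all add: pderiv_L_entry\<close>)

lemma pderiv_times_L:
  assumes "k \<in> {1..N}"
  shows "pderiv (times_L p k) = times_L (\<lambda>m. pderiv (p m) + Polynomial.smult 2 (times_A p m)) k"
  unfolding times_L_add times_L_smult times_pderiv_L_entry[OF assms, symmetric]
  by (simp add: times_L_def pderiv_sum pderiv_mult sum.distrib mult.commute)

lemma creation_times_L: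
  assumes "k \<in> {1..N}"
  shows "creation (times_L p k) = times_L (\<lambda>m. creation (p m) - Polynomial.smult 2 (times_A p m)) k"
  unfolding creation_def pderiv_times_L[OF assms] times_L_diff times_L_add times_L_mult by simp

text \<open>The product rule produces the mixed term \<open>- 2 p' L'\<close>, which is \<open>- 4 p' A L\<close>; the terms in which only \<open>L\<close> is
differentiated cancel against \<open>2 p L J\<close> up to \<open>2 p J L\<close>, by \<open>L_entry_rec\<close>. In particular no power of \<open>x\<close> is
gained.\<close>

lemma second_order_times_L:
  assumes k: "k \<in> {1..N}"
  shows "second_order (times_L p) k =
    times_L (\<lambda>m. second_order p m - Polynomial.smult 4 (times_A (\<lambda>i. pderiv (p i)) m)) k"
proof -
  have "second_order (times_L p) k = (\<Sum>m=1..N. hermite_op (p m * L_entry m k) + Polynomial.smult (2 * of_nat k) (p m * L_entry m k))"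
    by (simp add: second_order_def times_L_def hermite_op_def pderiv_sum sum_distrib_left sum_subtractf
       sum.distrib smult_sum2 del: mult_pCons_left)
  also have "\<dots> = (\<Sum>m=1..N. second_order p m * L_entry m k - Polynomial.smult 2 (pderiv (p m) * pderiv (L_entry m k)))"
  proof (rule sum.cong[OF refl])
    fix m assume "m \<in> {1..N}"
    define l where "l = L_entry m k"
    have lk: "Polynomial.smult (2 * of_nat k) l = Polynomial.smult 2 (Polynomial.smult (of_nat m) l
      - [:0, 1:] * pderiv l + Polynomial.smult (1/2) (pderiv (pderiv l)))"
      using L_entry_rec[OF k \<open>m \<in> {1..N}\<close>] unfolding l_def by (metis smult_smult)
    have "hermite_op (p m * l) + Polynomial.smult (2 * of_nat k) (p m * l)
       = hermite_op (p m * l) + p m * Polynomial.smult (2 * of_nat k) l" by simp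
    also have "\<dots> = second_order p m * l - Polynomial.smult 2 (pderiv (p m) * pderiv l)"
      unfolding lk hermite_op_def second_order_def
      by (simp add: pderiv_mult pderiv_add numeral_poly smult_add_right smult_diff_right algebra_simps)
    finally show "hermite_op (p m * L_entry m k) + Polynomial.smult (2 * of_nat k) (p m * L_entry m k)
       = second_order p m * L_entry m k - Polynomial.smult 2 (pderiv (p m) * pderiv (L_entry m k))"
      unfolding l_def .
  qed
  also have "\<dots> = times_L (second_order p) k - Polynomial.smult 2 (\<Sum>m=1..N. pderiv (p m) * pderiv (L_entry m k))"
    by (simp add: times_L_def sum_subtractf smult_sum2)
  also have "\<dots> = times_L (\<lambda>m. second_order p m - Polynomial.smult 4 (times_A (\<lambda>i. pderiv (p i)) m)) k"
    unfolding times_pderiv_L_entry[OF k] times_L_diff times_L_smult by simp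
  finally show ?thesis .
qed

definition row_inner :: "(nat \<Rightarrow> complex poly) \<Rightarrow> (nat \<Rightarrow> complex poly) \<Rightarrow> complex" where
  "row_inner u v = (\<Sum>k=1..N. gauss_inner (u k) (v k))"

lemma row_inner_cong:
  "(\<And>k. k \<in> {1..N} \<Longrightarrow> u k = u' k) \<Longrightarrow> (\<And>k. k \<in> {1..N} \<Longrightarrow> v k = v' k) \<Longrightarrow>
    row_inner u v = row_inner u' v'"
  by (simp add: row_inner_def)

lemma row_inner_commute: "row_inner u v = cnj (row_inner v u)"
  unfolding row_inner_def cnj_sum by (intro sum.cong refl gauss_inner_commute)

lemma row_inner_linear:
  "row_inner (\<lambda>k. u k + u' k) v = row_inner u v + row_inner u' v"
  "row_inner (\<lambda>k. u k - u' k) v = row_inner u v - row_inner u' v"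
  "row_inner (\<lambda>k. Polynomial.smult c (u k)) v = c * row_inner u v"
  by (simp_all add: row_inner_def gauss_inner_linear sum.distrib sum_subtractf sum_distrib_left)

lemma row_inner_linear_right:
  "row_inner u (\<lambda>k. v k + v' k) = row_inner u v + row_inner u v'"
  "row_inner u (\<lambda>k. v k - v' k) = row_inner u v - row_inner u v'"
  "row_inner u (\<lambda>k. Polynomial.smult c (v k)) = cnj c * row_inner u v"
  by (simp_all add: row_inner_def gauss_inner_linear_right sum.distrib sum_subtractf sum_distrib_left)

lemma row_inner_sum_right: "row_inner u (\<lambda>k. \<Sum>i\<in>I. f i k) = (\<Sum>i\<in>I. row_inner u (f i))"
proof -
  have 0: "row_inner u (\<lambda>k. 0) = 0" using row_inner_linear_right(3)[of u 0 "\<lambda>k. 0"] by simp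
  show ?thesis
    by (induction I rule: infinite_finite_induct) (simp_all add: 0 row_inner_linear_right)
qed

lemma row_inner_pderiv: "row_inner (\<lambda>k. pderiv (u k)) v = row_inner u (\<lambda>k. creation (v k))"
  by (simp only: row_inner_def gauss_inner_pderiv creation_def)

lemma row_inner_second_order: "row_inner (second_order u) v = row_inner u (second_order v)"
proof -
  have "gauss_inner (second_order u k) (v k) = gauss_inner (u k) (second_order v k)" for k
    unfolding second_order_def gauss_inner_linear gauss_inner_linear_right gauss_inner_hermite_op by simp
  then show ?thesis by (simp add: row_inner_def)
qed

lemma row_inner_definite:
  assumes "row_inner u u = 0" "k \<in> {1..N}" shows "u k = 0"
proof -
  have "(\<Sum>k=1..N. Re (gauss_inner (u k) (u k))) = 0"
    using assms(1) unfolding row_inner_def by (simp flip: Re_sum)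
  then have "Re (gauss_inner (u k) (u k)) = 0"
    using assms(2) gauss_inner_nonneg(1) by (subst (asm) sum_nonneg_eq_0_iff) auto
  then show ?thesis using gauss_inner_definite gauss_inner_nonneg(2) by (simp add: complex_eq_iff)
qed

text \<open>For \<open>d = 0\<close> this says that all entries are \<open>0\<close>.\<close>

definition deg_less :: "nat \<Rightarrow> (nat \<Rightarrow> complex poly) \<Rightarrow> bool" where
  "deg_less d q \<longleftrightarrow> (\<forall>m\<in>{1..N}. \<forall>i\<ge>d. coeff (q m) i = 0)"

lemma L_entry_diag: "k \<in> {1..N} \<Longrightarrow> L_entry k k = 1"
  by (simp add: L_entry_def \<alpha>_nonzero)

text \<open>\<open>L\<close> is unipotent lower triangular, so the entries of \<open>q\<close> are recovered from the last one backwards.\<close>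

lemma times_L_eq_0:
  assumes "\<And>k. k \<in> {1..N} \<Longrightarrow> times_L q k = 0" "m \<in> {1..N}"
  shows "q m = 0"
  using assms(2)
proof (induction "N - m" arbitrary: m rule: less_induct)
  case less
  have "times_L q m = (\<Sum>i\<in>{m}. q i * L_entry i m)"
    unfolding times_L_def
  proof (rule sum.mono_neutral_right; safe?)
    fix i assume i: "i \<in> {1..N}" "i \<notin> {}" "q i * L_entry i m \<noteq> 0"
    show "i = m"
    proof (rule ccontr)
      assume "i \<noteq> m"
      moreover have "m \<le> i" using i(3) by (auto simp: L_entry_def split: if_splits)
      ultimately have "q i = 0" using i less by (intro less(1)) auto
      then show False using i by simp
    qed
  qed (use less in auto)
  then show ?case using assms(1)[OF less(2)] L_entry_diag[OF less(2)] by simp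
qed

lemma deg_less_mono: "deg_less d q \<Longrightarrow> d \<le> d' \<Longrightarrow> deg_less d' q"
  by (auto simp: deg_less_def)

lemma deg_less_second_order:
  assumes "deg_less d q"
  shows "deg_less d (\<lambda>m. second_order q m - Polynomial.smult 4 (times_A (\<lambda>i. pderiv (q i)) m))"
  using assms by (auto simp: deg_less_def coeff_hermite_op second_order_def coeff_pderiv times_A_def)

end

section \<open>Orthogonal rows and their differential relations\<close>

text \<open>Here \<open>p n j\<close> is row \<open>j\<close> of the monic orthogonal polynomial of degree \<open>n\<close>.\<close>

locale hermite_mvop = hermite_weight +
  fixes p :: "nat \<Rightarrow> nat \<Rightarrow> nat \<Rightarrow> complex poly"
  assumes degree_bound: "\<And>n j m i. j \<in> {1..N} \<Longrightarrow> m \<in> {1..N} \<Longrightarrow> i > n \<Longrightarrow> coeff (p n j m) i = 0"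
    and monic: "\<And>n j m. j \<in> {1..N} \<Longrightarrow> m \<in> {1..N} \<Longrightarrow> coeff (p n j m) n = (if j = m then 1 else 0)"
    and orthogonal: "\<And>n m j i. j \<in> {1..N} \<Longrightarrow> i \<in> {1..N} \<Longrightarrow> n \<noteq> m \<Longrightarrow> row_inner (times_L (p n j)) (times_L (p m i)) = 0"
begin

definition PL :: "nat \<Rightarrow> nat \<Rightarrow> nat \<Rightarrow> complex poly" where
  "PL n j = times_L (p n j)"

lemma coeff_p:
  "j \<in> {1..N} \<Longrightarrow> m \<in> {1..N} \<Longrightarrow> n \<le> i \<Longrightarrow> coeff (p n j m) i = (if i = n \<and> j = m then 1 else 0)"
  using degree_bound[of j m n i] monic[of j m n] by (cases "i = n") auto

lemma deg_less_p: "j \<in> {1..N} \<Longrightarrow> deg_less (Suc n) (p n j)"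
  by (simp add: deg_less_def degree_bound)

text \<open>The rows \<open>PL m i\<close> with \<open>m < d\<close> span all \<open>times_L q\<close> with \<open>deg_less d q\<close>.\<close>

lemma row_inner_times_L_eq_0:
  assumes "\<And>m i. m < d \<Longrightarrow> i \<in> {1..N} \<Longrightarrow> row_inner w (PL m i) = 0" "deg_less d q"
  shows "row_inner w (times_L q) = 0"
  using assms
proof (induction d arbitrary: q)
  case 0
  then have "q m = 0" if "m \<in> {1..N}" for m
    using that by (intro poly_eqI) (simp add: deg_less_def)
  then have "times_L q k = 0" for k by (simp add: times_L_def)
  then show ?case using row_inner_sum_right[of w _ "{}"] by (simp add: row_inner_def gauss_inner_def)
next
  case (Suc d)
  \<comment> \<open>The polynomials of degree \<open>d\<close> are monic, so this combination of their rows removes the terms of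
    degree \<open>d\<close> from \<open>q\<close>.\<close>
  define c where "c i = coeff (q i) d" for i
  define q' where "q' = (\<lambda>m. q m - (\<Sum>i=1..N. Polynomial.smult (c i) (p d i m)))"
  have "deg_less d q'"
    unfolding deg_less_def
  proof (intro ballI allI impI)
    fix m i assume m: "m \<in> {1..N}" and i: "d \<le> i"
    show "coeff (q' m) i = 0"
    proof (cases "i = d")
      case True
      have "(\<Sum>l=1..N. c l * coeff (p d l m) d) = (\<Sum>l\<in>{1..N}. if l = m then c l else 0)"
        using m by (intro sum.cong refl) (auto simp: monic)
      then show ?thesis using m True by (simp add: q'_def coeff_sum c_def)
    next
      case False
      then show ?thesis using Suc.prems(2) m i
        by (simp add: q'_def coeff_sum degree_bound deg_less_def)
    qed
  qed
  then have "row_inner w (times_L q') = 0" using Suc by simp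
  moreover have "times_L q' = (\<lambda>k. times_L q k - (\<Sum>i=1..N. Polynomial.smult (c i) (PL d i k)))"
    by (simp add: q'_def times_L_diff times_L_sum times_L_smult PL_def fun_eq_iff)
  ultimately show ?case
    using Suc.prems(1) by (simp add: row_inner_linear_right row_inner_sum_right)
qed

lemma PL_orthogonal_deg_less:
  assumes "j \<in> {1..N}" "deg_less n q"
  shows "row_inner (PL n j) (times_L q) = 0"
  using assms orthogonal by (intro row_inner_times_L_eq_0[of n]) (auto simp: PL_def)

text \<open>The element \<open>w\<close> is orthogonal to a space that contains it, so its norm is \<open>0\<close>.\<close>

lemma deg_less_orthogonal_eq_0:
  assumes "\<And>k. k \<in> {1..N} \<Longrightarrow> w k = times_L q k" "deg_less d q"
    and "\<And>m i. m < d \<Longrightarrow> i \<in> {1..N} \<Longrightarrow> row_inner w (PL m i) = 0" and "k \<in> {1..N}"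
  shows "w k = 0"
proof -
  have "row_inner w w = row_inner w (times_L q)" using assms(1) by (intro row_inner_cong) auto
  also have "\<dots> = 0" using assms by (intro row_inner_times_L_eq_0) auto
  finally show ?thesis using row_inner_definite assms by blast
qed

text \<open>In the difference of both sides the coefficient of \<open>x\<^sup>n\<close> cancels: the operator acts on it as \<open>2 n + 2 J\<close>, and
\<open>J\<close> acts on the unit row \<open>j\<close> as \<open>j\<close>. The difference is orthogonal to all \<open>PL m i\<close> with \<open>m < n\<close> because the
operator is symmetric and does not raise the degree.\<close>

lemma PL_eigen:
  assumes j: "j \<in> {1..N}" and k: "k \<in> {1..N}"
  shows "second_order (PL n j) k = Polynomial.smult (2 * of_nat (n + j)) (PL n j k)"
proof -
  define q where "q = (\<lambda>m. second_order (p n j) m - Polynomial.smult 4 (times_A (\<lambda>i. pderiv (p n j i)) m)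
     - Polynomial.smult (2 * of_nat (n + j)) (p n j m))"
  define w where "w = (\<lambda>k. second_order (PL n j) k - Polynomial.smult (2 * of_nat (n + j)) (PL n j k))"
  have "w k = 0"
  proof (rule deg_less_orthogonal_eq_0)
    show "w k = times_L q k" if "k \<in> {1..N}" for k
      by (simp only: w_def q_def PL_def second_order_times_L[OF that] times_L_diff times_L_smult)
    show "deg_less n q"
      using j unfolding deg_less_def q_def second_order_def times_A_def
      by (auto simp: coeff_hermite_op coeff_pderiv coeff_p Suc_le_eq algebra_simps)
    fix m i assume m: "m < n" and i: "i \<in> {1..N}"
    let ?s = "\<lambda>l. second_order (p m i) l - Polynomial.smult 4 (times_A (\<lambda>i'. pderiv (p m i i')) l)"
    have "row_inner (PL n j) (second_order (PL m i)) = row_inner (PL n j) (times_L ?s)"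
      unfolding PL_def by (intro row_inner_cong refl second_order_times_L)
    also have "\<dots> = 0"
      using m by (intro PL_orthogonal_deg_less j deg_less_mono[OF deg_less_second_order[OF deg_less_p[OF i]]]) auto
    finally show "row_inner w (PL m i) = 0"
      unfolding w_def row_inner_linear row_inner_second_order using m orthogonal[OF j i, of n m] by (simp add: PL_def)
  qed fact
  then show ?thesis by (simp add: w_def)
qed

text \<open>Eigenvectors of a symmetric operator for distinct eigenvalues; this is diagonality of the squared norms.\<close>

lemma PL_orthogonal_rows:
  assumes "j \<in> {1..N}" "i \<in> {1..N}" "i \<noteq> j"
  shows "row_inner (PL n j) (PL n i) = 0"
proof -
  have l: "row_inner (second_order (PL n j)) (PL n i) = 2 * of_nat (n + j) * row_inner (PL n j) (PL n i)"
    unfolding row_inner_linear(3)[symmetric] using assms by (intro row_inner_cong PL_eigen refl) auto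
  have r: "row_inner (PL n j) (second_order (PL n i)) = cnj (2 * of_nat (n + i)) * row_inner (PL n j) (PL n i)"
    unfolding row_inner_linear_right(3)[symmetric] using assms by (intro row_inner_cong PL_eigen refl) auto
  have "of_nat (n + j) * row_inner (PL n j) (PL n i) = of_nat (n + i) * row_inner (PL n j) (PL n i)"
    using l r by (auto simp: row_inner_second_order)
  then show ?thesis using assms(3) by auto
qed

definition sqnorm :: "nat \<Rightarrow> nat \<Rightarrow> complex" where
  "sqnorm n j = row_inner (PL n j) (PL n j)"

lemma row_inner_PL:
  assumes "j \<in> {1..N}" "i \<in> {1..N}"
  shows "row_inner (PL n j) (PL m i) = (if n = m \<and> j = i then sqnorm n j else 0)"
  using PL_orthogonal_rows orthogonal[OF assms, of n m] assms by (auto simp: PL_def sqnorm_def)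

lemma sqnorm_nonzero:
  assumes j: "j \<in> {1..N}" shows "sqnorm n j \<noteq> 0"
proof
  assume "sqnorm n j = 0"
  then have "p n j j = 0"
    using times_L_eq_0[of "p n j" j] row_inner_definite[of "PL n j"] j by (auto simp: sqnorm_def PL_def)
  then show False using monic[OF j j, of n] by simp
qed

text \<open>The nonzero entry of row \<open>j\<close> of \<open>A\<close>. The value \<open>0\<close> for \<open>j = 1\<close> accounts for the empty first row and makes
terms with the index \<open>j - 1 = 0\<close> vanish.\<close>

definition ratio :: "nat \<Rightarrow> complex" where
  "ratio j = (if 2 \<le> j then a j / a (j - 1) else 0)"

lemma cnj_ratio [simp]: "cnj (ratio j) = ratio j" by (simp add: ratio_def)

text \<open>The leading term of \<open>(P L)' = (P' + 2 P A) L\<close> is that of \<open>2 A P L\<close>, as \<open>P\<close> is monic.\<close>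

lemma pderiv_PL_leading:
  assumes j: "j \<in> {1..N}"
  obtains q where "deg_less n q"
    "\<And>k. k \<in> {1..N} \<Longrightarrow> pderiv (PL n j k) = Polynomial.smult (2 * ratio j) (PL n (j - 1) k) + times_L q k"
proof
  let ?q = "\<lambda>m. pderiv (p n j m) + Polynomial.smult 2 (times_A (p n j) m) - Polynomial.smult (2 * ratio j) (p n (j - 1) m)"
  show "pderiv (PL n j k) = Polynomial.smult (2 * ratio j) (PL n (j - 1) k) + times_L ?q k" if "k \<in> {1..N}" for k
    by (simp add: PL_def pderiv_times_L[OF that] times_L_diff times_L_smult)
  show "deg_less n ?q"
    unfolding deg_less_def
  proof (intro ballI allI impI)
    fix m i assume m: "m \<in> {1..N}" and i: "n \<le> i"
    have z: "coeff (pderiv (p n j m)) i = 0" using i j m by (simp add: coeff_pderiv coeff_p)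
    show "coeff (?q m) i = 0"
    proof (cases "2 \<le> j")
      case True
      then have j': "j - 1 \<in> {1..N}" using j by auto
      have "coeff (Polynomial.smult 2 (times_A (p n j) m)) i = (if i = n \<and> m + 1 = j then 2 * ratio j else 0)"
        using True i m j by (auto simp: times_A_def ratio_def coeff_p Suc_le_eq)
      moreover have "coeff (p n (j - 1) m) i = (if i = n \<and> m + 1 = j then 1 else 0)"
        using True i m j' by (auto simp: coeff_p Suc_le_eq)
      ultimately show ?thesis using z by simp
    next
      case False
      then show ?thesis using z i m j by (auto simp: times_A_def ratio_def coeff_p Suc_le_eq)
    qed
  qed
qed

text \<open>The leading term of \<open>2 x P L - (P L)' = (2 x P - P' - 2 P A) L\<close> comes from \<open>2 x P\<close> alone.\<close>

lemma creation_PL_leading: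
  assumes j: "j \<in> {1..N}"
  obtains q where "deg_less (Suc n) q"
    "\<And>k. k \<in> {1..N} \<Longrightarrow> creation (PL n j k) = Polynomial.smult 2 (PL (Suc n) j k) + times_L q k"
proof
  let ?q = "\<lambda>m. creation (p n j m) - Polynomial.smult 2 (times_A (p n j) m) - Polynomial.smult 2 (p (Suc n) j m)"
  show "creation (PL n j k) = Polynomial.smult 2 (PL (Suc n) j k) + times_L ?q k" if "k \<in> {1..N}" for k
    by (simp add: PL_def creation_times_L[OF that] times_L_diff times_L_smult)
  show "deg_less (Suc n) ?q"
    unfolding deg_less_def
  proof (intro ballI allI impI)
    fix m i assume m: "m \<in> {1..N}" and i: "Suc n \<le> i"
    then obtain l where l: "i = Suc l" "n \<le> l" by (cases i) auto
    then show "coeff (?q m) i = 0"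
      using j m by (auto simp: coeff_creation times_A_def coeff_p Suc_le_eq)
  qed
qed

lemma row_inner_PL_creation:
  assumes j: "j \<in> {1..N}" and i: "i \<in> {1..N}" and m: "m \<le> n"
  shows "row_inner (PL (Suc n) j) (\<lambda>k. creation (PL m i k)) = (if m = n \<and> i = j then 2 * sqnorm (Suc n) j else 0)"
proof -
  obtain q where q: "deg_less (Suc m) q"
    "\<And>k. k \<in> {1..N} \<Longrightarrow> creation (PL m i k) = Polynomial.smult 2 (PL (Suc m) i k) + times_L q k"
    using creation_PL_leading[OF i, where n = m] by blast
  have "row_inner (PL (Suc n) j) (\<lambda>k. creation (PL m i k)) =
      row_inner (PL (Suc n) j) (\<lambda>k. Polynomial.smult 2 (PL (Suc m) i k) + times_L q k)"
    using q by (intro row_inner_cong) auto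
  also have "\<dots> = 2 * row_inner (PL (Suc n) j) (PL (Suc m) i)"
    using PL_orthogonal_deg_less[OF j deg_less_mono[OF q(1), of "Suc n"]] m
    by (simp add: row_inner_linear_right)
  finally show ?thesis using i j by (auto simp: row_inner_PL)
qed

lemma row_inner_creation_PL:
  assumes j: "j \<in> {1..N}" and i: "i \<in> {1..N}" and m: "m \<le> n"
  shows "row_inner (\<lambda>k. creation (PL n j k)) (PL m i) = (if m = n \<and> i = j + 1 then 2 * ratio i * sqnorm n j else 0)"
proof -
  obtain q where q: "deg_less m q"
    "\<And>k. k \<in> {1..N} \<Longrightarrow> pderiv (PL m i k) = Polynomial.smult (2 * ratio i) (PL m (i - 1) k) + times_L q k"
    using pderiv_PL_leading[OF i, where n = m] by blast
  have "row_inner (\<lambda>k. creation (PL n j k)) (PL m i) = row_inner (PL n j) (\<lambda>k. pderiv (PL m i k))"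
    unfolding row_inner_commute[of "\<lambda>k. creation (PL n j k)"] row_inner_commute[of "PL n j"] row_inner_pderiv ..
  also have "\<dots> = row_inner (PL n j) (\<lambda>k. Polynomial.smult (2 * ratio i) (PL m (i - 1) k) + times_L q k)"
    using q by (intro row_inner_cong) auto
  also have "\<dots> = 2 * ratio i * row_inner (PL n j) (PL m (i - 1))"
    using PL_orthogonal_deg_less[OF j deg_less_mono[OF q(1) m]]
    by (simp add: row_inner_linear_right)
  also have "\<dots> = (if m = n \<and> i = j + 1 then 2 * ratio i * sqnorm n j else 0)"
  proof (cases "2 \<le> i")
    case True
    then have "i - 1 \<in> {1..N}" using i by auto
    then show ?thesis using True j by (auto simp: row_inner_PL)
  next
    case False
    then show ?thesis using j by (auto simp: ratio_def)
  qed
  finally show ?thesis .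
qed

text \<open>Once the leading terms are removed, \<open>PL (Suc n) j\<close> differentiated can only have components along
\<open>PL m i\<close> with \<open>m \<le> n\<close>. Moving the derivative to the other side raises the degree of \<open>PL m i\<close> by one, so that
only \<open>m = n\<close> and \<open>i = j\<close> contribute.\<close>

lemma lowering_relation:
  assumes j: "j \<in> {1..N}" and k: "k \<in> {1..N}"
  shows "pderiv (PL (Suc n) j k) = Polynomial.smult (2 * ratio j) (PL (Suc n) (j - 1) k)
     + Polynomial.smult (2 * sqnorm (Suc n) j / sqnorm n j) (PL n j k)"
proof -
  define w where "w = (\<lambda>k. pderiv (PL (Suc n) j k) - Polynomial.smult (2 * ratio j) (PL (Suc n) (j - 1) k)
     - Polynomial.smult (2 * sqnorm (Suc n) j / sqnorm n j) (PL n j k))"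
  obtain q where q: "deg_less (Suc n) q"
    "\<And>k. k \<in> {1..N} \<Longrightarrow> pderiv (PL (Suc n) j k) = Polynomial.smult (2 * ratio j) (PL (Suc n) (j - 1) k) + times_L q k"
    using pderiv_PL_leading[OF j, where n = "Suc n"] by blast
  have "w k = 0"
  proof (rule deg_less_orthogonal_eq_0[where d = "Suc n"])
    show "w k = times_L (\<lambda>m. q m - Polynomial.smult (2 * sqnorm (Suc n) j / sqnorm n j) (p n j m)) k"
      if "k \<in> {1..N}" for k
      by (simp add: w_def q(2)[OF that] times_L_diff times_L_smult PL_def[symmetric])
    show "deg_less (Suc n) (\<lambda>m. q m - Polynomial.smult (2 * sqnorm (Suc n) j / sqnorm n j) (p n j m))"
      using q(1) deg_less_p[OF j, of n] by (simp add: deg_less_def)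
    fix m i assume m: "m < Suc n" and i: "i \<in> {1..N}"
    have "ratio j * row_inner (PL (Suc n) (j - 1)) (PL m i) = 0"
    proof (cases "2 \<le> j")
      case True
      then have "j - 1 \<in> {1..N}" using j by auto
      then show ?thesis using m i by (simp add: row_inner_PL)
    qed (simp add: ratio_def)
    then have "row_inner w (PL m i) = row_inner (PL (Suc n) j) (\<lambda>k. creation (PL m i k))
       - 2 * sqnorm (Suc n) j / sqnorm n j * row_inner (PL n j) (PL m i)"
      by (simp add: w_def row_inner_linear row_inner_pderiv)
    then show "row_inner w (PL m i) = 0"
      using m i j sqnorm_nonzero[OF j, of n] by (auto simp: row_inner_PL_creation row_inner_PL)
  qed fact
  then show ?thesis by (simp add: w_def algebra_simps)
qed

text \<open>Dual to the previous relation: by adjunction, the components along \<open>PL n i\<close> come from the leading term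
\<open>2 A\<close> of the derivative, whose adjoint relates row \<open>j\<close> to row \<open>j + 1\<close>.\<close>

lemma raising_relation:
  assumes j: "j \<in> {1..N}" and k: "k \<in> {1..N}"
  shows "creation (PL n j k) = Polynomial.smult 2 (PL (Suc n) j k)
     + Polynomial.smult (if j < N then 2 * ratio (j + 1) * sqnorm n j / sqnorm n (j + 1) else 0) (PL n (j + 1) k)"
proof -
  define c where "c = (if j < N then 2 * ratio (j + 1) * sqnorm n j / sqnorm n (j + 1) else 0)"
  define w where "w = (\<lambda>k. creation (PL n j k) - Polynomial.smult 2 (PL (Suc n) j k)
     - Polynomial.smult c (PL n (j + 1) k))"
  obtain q where q: "deg_less (Suc n) q"
    "\<And>k. k \<in> {1..N} \<Longrightarrow> creation (PL n j k) = Polynomial.smult 2 (PL (Suc n) j k) + times_L q k"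
    using creation_PL_leading[OF j, where n = n] by blast
  have "w k = 0"
  proof (rule deg_less_orthogonal_eq_0[where d = "Suc n"])
    show "w k = times_L (\<lambda>m. q m - Polynomial.smult c (p n (j + 1) m)) k"
      if "k \<in> {1..N}" for k
      by (simp add: w_def q(2)[OF that] times_L_diff times_L_smult PL_def[symmetric])
    show "deg_less (Suc n) (\<lambda>m. q m - Polynomial.smult c (p n (j + 1) m))"
      using q(1) j deg_less_p[of "j + 1" n] by (auto simp: deg_less_def c_def)
    fix m i assume m: "m < Suc n" and i: "i \<in> {1..N}"
    have "row_inner w (PL m i) = row_inner (\<lambda>k. creation (PL n j k)) (PL m i) - c * row_inner (PL n (j + 1)) (PL m i)"
      using m i j by (simp add: w_def row_inner_linear row_inner_PL)
    also have "c * row_inner (PL n (j + 1)) (PL m i) = (if m = n \<and> i = j + 1 then 2 * ratio i * sqnorm n j else 0)"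
    proof (cases "j < N")
      case True
      then have "j + 1 \<in> {1..N}" by simp
      then show ?thesis using i sqnorm_nonzero[of "j + 1" n] by (auto simp: row_inner_PL c_def)
    qed (use i in \<open>simp add: c_def\<close>)
    finally show "row_inner w (PL m i) = 0"
      using m i j by (simp add: row_inner_creation_PL)
  qed fact
  then show ?thesis by (simp add: w_def c_def algebra_simps)
qed

section \<open>The recurrence for the Hermite coefficients\<close>

lemma PL_hermite:
  assumes j: "j \<in> {1..N}" and k: "k \<in> {1..N}"
  shows "\<exists>c. PL n j k = (if k \<le> n + j then Polynomial.smult c (hermite_c (n + j - k)) else 0)"
proof -
  have "hermite_op (PL n j k) = second_order (PL n j) k - Polynomial.smult (2 * of_nat k) (PL n j k)"
    by (simp add: second_order_def)
  also have "\<dots> = Polynomial.smult (2 * of_int (int (n + j) - int k)) (PL n j k)"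
    unfolding PL_eigen[OF j k] by (simp add: smult_diff_left[symmetric] algebra_simps)
  finally obtain c where c: "PL n j k = (if int (n + j) - int k \<ge> 0
      then Polynomial.smult c (hermite_c (nat (int (n + j) - int k))) else 0)"
    by (metis hermite_eigenvector)
  have "nat (int (n + j) - int k) = n + j - k" by arith
  then show ?thesis by (intro exI[of _ c]) (simp add: c)
qed

text \<open>The constant \<open>\<xi>(n, j, k)\<close>, read off from the leading coefficient \<open>2 ^ m\<close> of the Hermite polynomial \<open>H\<^sub>m\<close>. The
value \<open>0\<close> for \<open>k > n + j\<close> makes the truncated difference \<open>n + j - k\<close> harmless in \<open>PL_eq_hcoeff\<close>.\<close>

definition hcoeff :: "nat \<Rightarrow> nat \<Rightarrow> nat \<Rightarrow> complex" where
  "hcoeff n j k = (if k \<le> n + j then coeff (PL n j k) (n + j - k) / 2 ^ (n + j - k) else 0)"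

lemma PL_eq_hcoeff:
  assumes "j \<in> {1..N}" "k \<in> {1..N}"
  shows "PL n j k = Polynomial.smult (hcoeff n j k) (hermite_c (n + j - k))"
  using PL_hermite[OF assms, of n] by (auto simp: hcoeff_def coeff_hermite_c)

text \<open>The coefficients of \<open>H\<^sub>n\<^sub>+\<^sub>j\<^sub>-\<^sub>k\<close> in the lowering relation at degree \<open>n + 1\<close>. If the index is negative, then
both sides are \<open>0\<close>, the left one because of the factor when \<open>k = n + 1 + j\<close>.\<close>

lemma hcoeff_lowering:
  assumes j: "j \<in> {2..N}" and k: "k \<in> {1..N}"
  shows "of_int (int (Suc n) + int j - int k) * hcoeff (Suc n) j k =
    ratio j * hcoeff (Suc n) (j - 1) k + sqnorm (Suc n) j / sqnorm n j * hcoeff n j k"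
proof (cases "k < Suc n + j")
  case False
  then have "hcoeff n j k = 0" "hcoeff (Suc n) (j - 1) k = 0"
      "hcoeff (Suc n) j k = 0 \<or> int (Suc n) + int j - int k = 0"
    using j by (auto simp: hcoeff_def)
  then show ?thesis by (elim disjE) (simp_all only: of_int_0 mult_zero_left mult_zero_right add_0)
next
  case True
  define d where "d = n + j - k"
  have e: "Suc n + j - k = Suc d" "Suc n + (j - 1) - k = d" using True j by (auto simp: d_def)
  have jj: "j \<in> {1..N}" "j - 1 \<in> {1..N}" using j by auto
  have "coeff (pderiv (PL (Suc n) j k)) d = 2 ^ d * (2 * (of_nat (Suc d) * hcoeff (Suc n) j k))"
    unfolding PL_eq_hcoeff[OF jj(1) k] e pderiv_smult pderiv_hermite_c
    by (simp add: coeff_hermite_c algebra_simps)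
  moreover have "coeff (Polynomial.smult (2 * ratio j) (PL (Suc n) (j - 1) k)
     + Polynomial.smult (2 * sqnorm (Suc n) j / sqnorm n j) (PL n j k)) d
     = 2 ^ d * (2 * (ratio j * hcoeff (Suc n) (j - 1) k + sqnorm (Suc n) j / sqnorm n j * hcoeff n j k))"
    unfolding PL_eq_hcoeff[OF jj(1) k] PL_eq_hcoeff[OF jj(2) k] e(2) d_def[symmetric]
    by (simp add: coeff_hermite_c algebra_simps)
  ultimately have "of_nat (Suc d) * hcoeff (Suc n) j k =
    ratio j * hcoeff (Suc n) (j - 1) k + sqnorm (Suc n) j / sqnorm n j * hcoeff n j k"
    unfolding lowering_relation[OF jj(1) k]
    by (metis mult_cancel_left power_not_zero zero_neq_numeral)
  moreover have "int (Suc n) + int j - int k = int (Suc d)" using True by (simp add: d_def)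
  ultimately show ?thesis by (simp only: of_int_of_nat_eq)
qed

text \<open>The coefficients of \<open>H\<^sub>n\<^sub>+\<^sub>1\<^sub>+\<^sub>j\<^sub>-\<^sub>k\<close> in the raising relation. For \<open>k = n + 1 + j\<close> this compares constants, and
the left-hand side is \<open>0\<close>.\<close>

lemma hcoeff_raising:
  assumes j: "j \<in> {1..N}" and k: "k \<in> {1..N}"
  shows "hcoeff n j k = 2 * hcoeff (Suc n) j k
    + (if j < N then 2 * ratio (j + 1) * sqnorm n j / sqnorm n (j + 1) * hcoeff n (j + 1) k else 0)"
proof (cases "k \<le> Suc n + j")
  case False
  then show ?thesis by (simp add: hcoeff_def)
next
  case True
  define d where "d = Suc n + j - k"
  have l: "creation (PL n j k) = Polynomial.smult (hcoeff n j k) (hermite_c d)"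
  proof (cases "k \<le> n + j")
    case True
    then have "d = Suc (n + j - k)" by (simp add: d_def)
    then show ?thesis
      by (simp only: PL_eq_hcoeff[OF j k] creation_smult creation_hermite_c)
  next
    case False
    then show ?thesis by (simp add: PL_eq_hcoeff[OF j k] hcoeff_def)
  qed
  have "PL n (j + 1) k = Polynomial.smult (hcoeff n (j + 1) k) (hermite_c d)" if "j < N"
    using that k by (subst PL_eq_hcoeff) (auto simp: d_def)
  moreover have "PL (Suc n) j k = Polynomial.smult (hcoeff (Suc n) j k) (hermite_c d)"
    by (simp only: PL_eq_hcoeff j k d_def)
  ultimately have "coeff (Polynomial.smult (hcoeff n j k) (hermite_c d)) d =
     coeff (Polynomial.smult (2 * hcoeff (Suc n) j k
    + (if j < N then 2 * ratio (j + 1) * sqnorm n j / sqnorm n (j + 1) * hcoeff n (j + 1) k else 0)) (hermite_c d)) d"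
    unfolding l[symmetric] raising_relation[OF j k] by (auto simp: distrib_right)
  then show ?thesis by (simp add: coeff_hermite_c)
qed

lemma hcoeff_recurrence:
  assumes n: "n \<ge> 1" and j: "j \<in> {2..N}" and k: "k \<in> {1..N}"
  shows "hcoeff n (j - 1) k =
     (if j < N then
        (a (j - 1) / a j * of_int (int n + int j - int k)
          + 2 * (a (j - 1) * a (j + 1) ^ 2 / a j ^ 3) * (sqnorm n j / sqnorm n (j + 1))
          - 2 * (a (j - 1) / a j) * (sqnorm n j / sqnorm (n - 1) j)) * hcoeff n j k
        - 2 * of_int (int n + int j - int k + 1) * (a (j - 1) * a (j + 1) / a j ^ 2)
          * (sqnorm n j / sqnorm n (j + 1)) * hcoeff n (j + 1) k
      else (a (j - 1) / a j * of_int (int n + int j - int k)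
          - 2 * (a (j - 1) / a j) * (sqnorm n j / sqnorm (n - 1) j)) * hcoeff n j k)"
proof -
  obtain m where m: "n = Suc m" using n by (cases n) auto
  have jj: "j \<in> {1..N}" "j - 1 \<in> {1..N}" using j by auto
  have a0: "a j \<noteq> 0" "a (j - 1) \<noteq> 0" using \<alpha>_nonzero[OF jj(1)] \<alpha>_nonzero[OF jj(2)] by auto
  have h0: "sqnorm n j \<noteq> 0" "sqnorm m j \<noteq> 0" using sqnorm_nonzero jj by auto
  define z :: complex where "z = of_int (int n + int j - int k)"
  \<comment> \<open>The quantity to be eliminated is \<open>hcoeff m j k\<close>, of degree \<open>m = n - 1\<close>.\<close>
  have 1: "hcoeff n (j - 1) k = a (j - 1) / a j * (z * hcoeff n j k - sqnorm n j / sqnorm m j * hcoeff m j k)"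
    using hcoeff_lowering[OF j k, of m] a0 j by (simp add: m z_def ratio_def field_simps)
  show ?thesis
  proof (cases "j < N")
    case False
    then have 2: "hcoeff m j k = 2 * hcoeff n j k" using hcoeff_raising[OF jj(1) k, of m] by (simp add: m)
    show ?thesis unfolding 1 2 z_def[symmetric] using False a0 h0 by (simp add: m field_simps)
  next
    case True
    then have j1: "j + 1 \<in> {2..N}" "j + 1 \<in> {1..N}" using j by auto
    have a1: "a (j + 1) \<noteq> 0" using \<alpha>_nonzero[OF j1(2)] by simp
    have h1: "sqnorm n (j + 1) \<noteq> 0" "sqnorm m (j + 1) \<noteq> 0" using sqnorm_nonzero j1 by auto
    have ratio: "ratio (j + 1) = a (j + 1) / a j" using j by (simp add: ratio_def)
    have 2: "hcoeff m j k = 2 * hcoeff n j k + 2 * (a (j + 1) / a j) * sqnorm m j / sqnorm m (j + 1) * hcoeff m (j + 1) k"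
      using hcoeff_raising[OF jj(1) k, of m] True unfolding ratio by (simp add: m)
    have 3: "hcoeff m (j + 1) k / sqnorm m (j + 1) = ((z + 1) * hcoeff n (j + 1) k - a (j + 1) / a j * hcoeff n j k) / sqnorm n (j + 1)"
    proof -
      have "(z + 1) * hcoeff n (j + 1) k = ratio (j + 1) * hcoeff n j k + sqnorm n (j + 1) / sqnorm m (j + 1) * hcoeff m (j + 1) k"
        using hcoeff_lowering[OF j1(1) k, of m] by (simp add: m z_def algebra_simps)
      then show ?thesis using h1 ratio by (simp add: field_simps)
    qed
    have "hcoeff m j k = 2 * hcoeff n j k + 2 * (a (j + 1) / a j) * sqnorm m j *
        (((z + 1) * hcoeff n (j + 1) k - a (j + 1) / a j * hcoeff n j k) / sqnorm n (j + 1))"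
      unfolding 2 3[symmetric] by simp
    then have "hcoeff n (j - 1) k = a (j - 1) / a j * (z * hcoeff n j k - sqnorm n j / sqnorm m j * (2 * hcoeff n j k + 2 * (a (j + 1) / a j) * sqnorm m j *
        (((z + 1) * hcoeff n (j + 1) k - a (j + 1) / a j * hcoeff n j k) / sqnorm n (j + 1))))"
      unfolding 1 by simp
    also have "\<dots> = (a (j - 1) / a j * z
          + 2 * (a (j - 1) * a (j + 1) ^ 2 / a j ^ 3) * (sqnorm n j / sqnorm n (j + 1))
          - 2 * (a (j - 1) / a j) * (sqnorm n j / sqnorm m j)) * hcoeff n j k
        - 2 * (z + 1) * (a (j - 1) * a (j + 1) / a j ^ 2)
          * (sqnorm n j / sqnorm n (j + 1)) * hcoeff n (j + 1) k"
      using a0 a1 h0 h1 by (simp add: divide_simps power2_eq_square power3_eq_cube) (simp add: algebra_simps)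
    finally show ?thesis using True by (simp add: m z_def)
  qed
qed

end

section \<open>Matrix polynomials and their rows\<close>

lemma pred_less: "j \<in> {1..N} \<Longrightarrow> j - 1 < (N :: nat)"
  by auto

lemma entry_mat1: "j \<in> {1..N} \<Longrightarrow> k \<in> {1..N} \<Longrightarrow> entry (mat1 N f) j k = f j k"
  using pred_less[of j N] pred_less[of k N] by (auto simp: entry_def mat1_def)

lemma entry_smult:
  "A \<in> carrier_mat N N \<Longrightarrow> j \<in> {1..N} \<Longrightarrow> k \<in> {1..N} \<Longrightarrow> entry (c \<cdot>\<^sub>m A) j k = c * entry A j k"
  using pred_less[of j N] pred_less[of k N] by (auto simp: entry_def)

lemma entry_times:
  assumes "A \<in> carrier_mat N N" "B \<in> carrier_mat N N" "j \<in> {1..N}" "k \<in> {1..N}"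
  shows "entry (A * B) j k = (\<Sum>m=1..N. entry A j m * entry B m k)"
proof -
  have "entry (A * B) j k = (\<Sum>i = 0..<N. A $$ (j - 1, i) * B $$ (i, k - 1))"
    using assms pred_less[OF assms(3)] pred_less[OF assms(4)] by (simp add: entry_def scalar_prod_def)
  also have "\<dots> = (\<Sum>m = Suc 0..<Suc N. A $$ (j - 1, m - 1) * B $$ (m - 1, k - 1))"
    by (subst sum.shift_bounds_Suc_ivl) simp
  finally show ?thesis by (simp add: entry_def atLeastLessThanSuc_atLeastAtMost)
qed

lemma mat_adjoint_carrier: "A \<in> carrier_mat N N \<Longrightarrow> mat_adjoint A \<in> carrier_mat N N"
  by (auto simp: mat_adjoint_def mat_of_rows_def)

lemma entry_mat_adjoint:
  fixes A :: "complex mat"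
  assumes "A \<in> carrier_mat N N" "j \<in> {1..N}" "k \<in> {1..N}"
  shows "entry (mat_adjoint A) j k = cnj (entry A k j)"
  using assms(1) pred_less[OF assms(2)] pred_less[OF assms(3)]
  by (simp add: entry_def mat_adjoint_def mat_of_rows_index)

lemma mpoly_eval_carrier: "A \<in> carrier_mat N N \<Longrightarrow> mpoly_eval A x \<in> carrier_mat N N"
  by (simp add: mpoly_eval_def)

lemma L_mat_carrier: "L_mat N \<alpha> x \<in> carrier_mat N N"
  by (simp add: L_mat_def mat1_def)

context hermite_weight
begin

lemma entry_eval_times_L_mat:
  assumes A: "A \<in> carrier_mat N N" and j: "j \<in> {1..N}" and k: "k \<in> {1..N}"
  shows "entry (mpoly_eval A x * L_mat N \<alpha> x) j k = poly (times_L (entry A j) k) (of_real x)"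
proof -
  have "entry (mpoly_eval A x) j m = poly (entry A j m) (of_real x)" if "m \<in> {1..N}" for m
    using A pred_less[OF j] pred_less[OF that] by (simp add: entry_def mpoly_eval_def)
  moreover have "entry (L_mat N \<alpha> x) m k = poly (L_entry m k) (of_real x)" if "m \<in> {1..N}" for m
    unfolding L_mat_def entry_mat1[OF that k] by (simp add: L_entry_def mult_ac)
  ultimately show ?thesis
    unfolding entry_times[OF mpoly_eval_carrier[OF A] L_mat_carrier j k]
    by (simp add: times_L_def poly_sum)
qed

text \<open>\<open>F W G\<^sup>*\<close> is \<open>exp (- y\<^sup>2)\<close> times \<open>(F L) (G L)\<^sup>*\<close>, so the matrix inner product is the one of the rows of \<open>F L\<close> and
\<open>G L\<close> with the scalar weight.\<close>

lemma entry_mat_inner: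
  assumes A: "A \<in> carrier_mat N N" and B: "B \<in> carrier_mat N N"
    and j: "j \<in> {1..N}" and i: "i \<in> {1..N}"
  shows "entry (mat_inner N (weight N \<alpha>) (mpoly_eval A) (mpoly_eval B)) j i =
    row_inner (times_L (entry A j)) (times_L (entry B i))"
proof -
  have "entry (mpoly_eval A y * weight N \<alpha> y * mat_adjoint (mpoly_eval B y)) j i =
     poly (\<Sum>k=1..N. times_L (entry A j) k * map_poly cnj (times_L (entry B i) k)) (of_real y) * of_real (exp (- y\<^sup>2))"
    for y
  proof -
    define F G L c where "F = mpoly_eval A y" and "G = mpoly_eval B y" and "L = L_mat N \<alpha> y"
      and "c = complex_of_real (exp (- y\<^sup>2))"
    have F: "F \<in> carrier_mat N N" and G: "G \<in> carrier_mat N N" and L: "L \<in> carrier_mat N N"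
      using A B by (simp_all add: F_def G_def L_def mpoly_eval_carrier L_mat_carrier)
    note G' = mat_adjoint_carrier[OF G] and L' = mat_adjoint_carrier[OF L]
    have LG: "entry (mat_adjoint L * mat_adjoint G) k i = cnj (entry (G * L) i k)"
      if k: "k \<in> {1..N}" for k
      unfolding entry_times[OF L' G' k i] entry_times[OF G L i k] cnj_sum
      by (intro sum.cong refl) (simp add: entry_mat_adjoint[OF L k] entry_mat_adjoint[OF G _ i])
    have "F * (c \<cdot>\<^sub>m (L * mat_adjoint L)) * mat_adjoint G = c \<cdot>\<^sub>m (F * (L * mat_adjoint L) * mat_adjoint G)"
      using F L L' G' by (simp add: mult_smult_distrib[of _ N N _ N] mult_smult_assoc_mat[of _ N N _ N])
    also have "F * (L * mat_adjoint L) * mat_adjoint G = (F * L) * (mat_adjoint L * mat_adjoint G)"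
      using F L L' G' by (simp add: assoc_mult_mat[of _ N N _ N _ N])
    finally have "entry (F * (c \<cdot>\<^sub>m (L * mat_adjoint L)) * mat_adjoint G) j i
       = c * entry ((F * L) * (mat_adjoint L * mat_adjoint G)) j i"
      using entry_smult[OF mult_carrier_mat[OF mult_carrier_mat[OF F L] mult_carrier_mat[OF L' G']] j i]
      by simp
    also have "entry ((F * L) * (mat_adjoint L * mat_adjoint G)) j i =
       (\<Sum>k=1..N. entry (F * L) j k * cnj (entry (G * L) i k))"
      using F L L' G' by (subst entry_times[OF _ _ j i]) (auto simp: LG intro!: sum.cong)
    also have "\<dots> = (\<Sum>k=1..N. poly (times_L (entry A j) k) (of_real y) * cnj (poly (times_L (entry B i) k) (of_real y)))"
      unfolding F_def G_def L_def
      by (intro sum.cong refl) (simp only: entry_eval_times_L_mat A B i j)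
    finally show ?thesis
      by (simp add: F_def G_def L_def c_def weight_def poly_sum mult.commute)
  qed
  then show ?thesis
    unfolding mat_inner_def entry_mat1[OF j i] row_inner_def gauss_inner_def gauss_sum[symmetric]
    by (simp only: gauss_def)
qed

end

lemma hermite_mvop_of_monic_mvops:
  assumes \<alpha>: "\<And>j. j \<in> {1..N} \<Longrightarrow> \<alpha> j > 0" and P: "monic_mvops N (weight N \<alpha>) P"
  shows "hermite_mvop N \<alpha> (\<lambda>n. entry (P n))"
proof -
  interpret hermite_weight N \<alpha>
    using \<alpha> by unfold_locales force
  have C: "P n \<in> carrier_mat N N" for n using P by (simp add: monic_mvops_def monic_mpoly_def)
  show ?thesis
  proof unfold_locales
    fix n j m i :: nat assume j: "j \<in> {1..N}" and m: "m \<in> {1..N}" and i: "n < i"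
    have "entry (P n) j m \<in> elements_mat (P n)"
      unfolding entry_def using pred_less[OF j] pred_less[OF m] by (intro elements_matI[OF C]) auto
    then have "degree (entry (P n) j m) \<le> n"
      using P by (simp add: monic_mvops_def monic_mpoly_def)
    then show "coeff (entry (P n) j m) i = 0" using i by (simp add: coeff_eq_0)
  next
    fix n j m :: nat assume j: "j \<in> {1..N}" and m: "m \<in> {1..N}"
    have "map_mat (\<lambda>p. coeff p n) (P n) = 1\<^sub>m N"
      using P by (simp add: monic_mvops_def monic_mpoly_def)
    then have "entry (map_mat (\<lambda>p. coeff p n) (P n)) j m = entry (1\<^sub>m N) j m" by simp
    then show "coeff (entry (P n) j m) n = (if j = m then 1 else 0)"
      using C[of n] j m pred_less[OF j] pred_less[OF m] by (auto simp: entry_def)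
  next
    fix n m j i :: nat assume j: "j \<in> {1..N}" and i: "i \<in> {1..N}" and "n \<noteq> m"
    then have "mat_inner N (weight N \<alpha>) (mpoly_eval (P n)) (mpoly_eval (P m)) = 0\<^sub>m N N"
      using P by (simp add: monic_mvops_def)
    then show "row_inner (times_L (entry (P n) j)) (times_L (entry (P m) i)) = 0"
      unfolding entry_mat_inner[OF C C j i, symmetric] using pred_less[OF i] pred_less[OF j] by (simp add: entry_def)
  qed
qed

text \<open>The constant that defines \<open>xi\<close> exists by \<open>PL_eq_hcoeff\<close>; it is unique because a Hermite polynomial does not
vanish identically.\<close>

lemma xi_eq_hcoeff:
  assumes \<alpha>: "\<And>j. j \<in> {1..N} \<Longrightarrow> \<alpha> j > 0" and P: "monic_mvops N (weight N \<alpha>) P"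
    and j: "j \<in> {1..N}" and k: "k \<in> {1..N}"
  shows "xi N \<alpha> P n j k = hermite_mvop.hcoeff N \<alpha> (\<lambda>n. entry (P n)) n j k"
proof -
  interpret hermite_mvop N \<alpha> "\<lambda>n. entry (P n)"
    by (rule hermite_mvop_of_monic_mvops[OF \<alpha> P])
  have C: "P n \<in> carrier_mat N N" using P by (simp add: monic_mvops_def monic_mpoly_def)
  define d where "d = n + j - k"
  have Q: "entry (Q_fun N \<alpha> P n t) j k = hcoeff n j k * of_real (hermite_fun d t * exp (- t\<^sup>2 / 2))" for t
  proof -
    have "entry (Q_fun N \<alpha> P n t) j k = of_real (exp (- t\<^sup>2 / 2)) * entry (mpoly_eval (P n) t * L_mat N \<alpha> t) j k"
      unfolding Q_fun_def
      by (rule entry_smult[OF mult_carrier_mat[OF mpoly_eval_carrier[OF C] L_mat_carrier] j k])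
    also have "\<dots> = of_real (exp (- t\<^sup>2 / 2)) * poly (PL n j k) (of_real t)"
      by (simp only: entry_eval_times_L_mat[OF C j k] PL_def)
    also have "\<dots> = hcoeff n j k * of_real (hermite_fun d t * exp (- t\<^sup>2 / 2))"
      by (simp add: PL_eq_hcoeff[OF j k] d_def)
    finally show ?thesis .
  qed
  have "hermite d \<noteq> 0" using lead_coeff_hermite[of d] by force
  then obtain t where t: "hermite_fun d t \<noteq> 0" using poly_all_0_iff_0 by blast
  have "(THE c. \<forall>t. entry (Q_fun N \<alpha> P n t) j k = c * of_real (hermite_fun d t * exp (- t\<^sup>2 / 2))) = hcoeff n j k"
  proof (rule the_equality)
    fix c assume "\<forall>t. entry (Q_fun N \<alpha> P n t) j k = c * of_real (hermite_fun d t * exp (- t\<^sup>2 / 2))"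
    then have "hcoeff n j k * of_real (hermite_fun d t * exp (- t\<^sup>2 / 2)) = c * of_real (hermite_fun d t * exp (- t\<^sup>2 / 2))"
      using Q by metis
    then show "c = hcoeff n j k" using t by simp
  qed (simp add: Q)
  then show ?thesis by (simp add: xi_def hcoeff_def d_def)
qed

theorem theorem5p14:
  fixes N :: nat and \<alpha> :: "nat \<Rightarrow> real" and P :: "nat \<Rightarrow> complex poly mat"
    and a :: "nat \<Rightarrow> complex" and H :: "nat \<Rightarrow> nat \<Rightarrow> complex"
    and \<xi> :: "nat \<Rightarrow> nat \<Rightarrow> nat \<Rightarrow> complex"
  assumes "\<And>j. j \<in> {1..N} \<Longrightarrow> \<alpha> j > 0"
    and "monic_mvops N (weight N \<alpha>) P"
  defines "a \<equiv> \<lambda>j. of_real (\<alpha> j)"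
    and "H \<equiv> \<lambda>n j. entry (sq_norm_mat N (weight N \<alpha>) P n) j j"
    and "\<xi> \<equiv> xi N \<alpha> P"
  shows "(\<forall>n\<ge>1. \<forall>k\<in>{1..N}. \<forall>j\<in>{2..N - 1}.
      \<xi> n (j - 1) k =
        (a (j - 1) / a j * of_int (int n + int j - int k)
          + 2 * (a (j - 1) * a (j + 1) ^ 2 / a j ^ 3) * (H n j / H n (j + 1))
          - 2 * (a (j - 1) / a j) * (H n j / H (n - 1) j)) * \<xi> n j k
        - 2 * of_int (int n + int j - int k + 1) * (a (j - 1) * a (j + 1) / a j ^ 2)
          * (H n j / H n (j + 1)) * \<xi> n (j + 1) k)
    \<and> (N \<ge> 2 \<longrightarrow> (\<forall>n\<ge>1. \<forall>k\<in>{1..N}.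
      \<xi> n (N - 1) k =
        (a (N - 1) / a N * of_int (int n + int N - int k)
          - 2 * (a (N - 1) / a N) * (H n N / H (n - 1) N)) * \<xi> n N k))"
proof -
  interpret M: hermite_mvop N \<alpha> "\<lambda>n. entry (P n)"
    by (rule hermite_mvop_of_monic_mvops[OF assms(1,2)])
  have C: "P n \<in> carrier_mat N N" for n
    using assms(2) by (simp add: monic_mvops_def monic_mpoly_def)
  have H: "H n j = M.sqnorm n j" if "j \<in> {1..N}" for n j
    by (simp only: H_def sq_norm_mat_def M.entry_mat_inner[OF C C that that] M.sqnorm_def M.PL_def)
  have \<xi>: "\<xi> n j k = M.hcoeff n j k" if "j \<in> {1..N}" "k \<in> {1..N}" for n j k
    unfolding \<xi>_def by (rule xi_eq_hcoeff[OF assms(1,2) that])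
  have inner: "\<xi> n (j - 1) k =
        (a (j - 1) / a j * of_int (int n + int j - int k)
          + 2 * (a (j - 1) * a (j + 1) ^ 2 / a j ^ 3) * (H n j / H n (j + 1))
          - 2 * (a (j - 1) / a j) * (H n j / H (n - 1) j)) * \<xi> n j k
        - 2 * of_int (int n + int j - int k + 1) * (a (j - 1) * a (j + 1) / a j ^ 2)
          * (H n j / H n (j + 1)) * \<xi> n (j + 1) k"
    if n: "n \<ge> 1" and k: "k \<in> {1..N}" and j: "j \<in> {2..N - 1}" for n j k
  proof -
    have jj: "j - 1 \<in> {1..N}" "j \<in> {1..N}" "j + 1 \<in> {1..N}" "j \<in> {2..N}" "j < N" using j by auto
    show ?thesis
      unfolding H[OF jj(2)] H[OF jj(3)] \<xi>[OF jj(1) k] \<xi>[OF jj(2) k] \<xi>[OF jj(3) k] a_def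
      using M.hcoeff_recurrence[OF n jj(4) k] jj(5) by (simp only: if_True)
  qed
  have last: "\<xi> n (N - 1) k =
        (a (N - 1) / a N * of_int (int n + int N - int k)
          - 2 * (a (N - 1) / a N) * (H n N / H (n - 1) N)) * \<xi> n N k"
    if N: "N \<ge> 2" and n: "n \<ge> 1" and k: "k \<in> {1..N}" for n k
  proof -
    have jj: "N - 1 \<in> {1..N}" "N \<in> {1..N}" "N \<in> {2..N}" using N by auto
    show ?thesis
      unfolding H[OF jj(2)] \<xi>[OF jj(1) k] \<xi>[OF jj(2) k] a_def
      using M.hcoeff_recurrence[OF n jj(3) k] by (simp only: less_irrefl if_False)
  qed
  show ?thesis using inner last by blast
qed

end
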